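(* There is an absolute constant $C>0$ such that the following holds for every integer $n \geq 1$ and every real $K \geq 1$. Suppose that $A \subseteq \operatorname{U}_n(\mathbb{C})$ is a finite symmetric set satisfying $|A^3| \leq K|A|$. Then there is a connected abelian subgroup $S \subseteq \operatorname{U}_n(\mathbb{C})$ such that $A$ lies in the normaliser $N(S)$ of $S$ in $\operatorname{U}_n(\mathbb{C})$, and such that the image of $A$ under the quotient homomorphism $\pi : N(S) \rightarrow N(S)/S$ has cardinality at most $n^{Cn^4}K^{Cn^2}$.
   Context: $\operatorname{U}_n(\mathbb{C})$ is the group of $n \times n$ complex unitary matrices. A subset $A$ of a group is symmetric if $a \in A$ implies $a^{-1} \in A$. $A^3 := \{a_1a_2a_3 : a_1,a_2,a_3 \in A\}$. *)

theory Defs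
  imports
    "HOL-Analysis.Analysis"
    "HOL-Algebra.Zassenhaus"
    "Jordan_Normal_Form.Schur_Decomposition"
begin

definition unitary_group :: "nat \<Rightarrow> complex mat monoid" where
  "unitary_group n =
    \<lparr>carrier = {M \<in> carrier_mat n n. mat_adjoint M * M = 1\<^sub>m n},
     mult = (*), one = 1\<^sub>m n\<rparr>"

(* The entrywise topology on n x n complex matrices.  The index function is restricted because
   topspace (product_topology X I) consists of functions that are extensional on I. *)
definition mat_topology :: "nat \<Rightarrow> complex mat topology" where
  "mat_topology n =
    pullback_topology (carrier_mat n n)
      (\<lambda>M. \<lambda>ij\<in>{..<n} \<times> {..<n}. M $$ ij)
      (product_topology (\<lambda>_. euclidean) ({..<n} \<times> {..<n}))"

definition symmetric_subset :: "('a, 'b) monoid_scheme \<Rightarrow> 'a set \<Rightarrow> bool" where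
  "symmetric_subset G A \<longleftrightarrow> A \<subseteq> carrier G \<and> (\<forall>a\<in>A. inv\<^bsub>G\<^esub> a \<in> A)"

lemma topspace_mat_topology [simp]: "topspace (mat_topology n) = carrier_mat n n"
  by (auto simp: mat_topology_def topspace_pullback_topology PiE_def)

lemma mat_adjoint_index:
  fixes M :: "complex mat"
  assumes "i < dim_col M" "j < dim_row M"
  shows "mat_adjoint M $$ (i, j) = cnj (M $$ (j, i))"
  using assms by (simp add: mat_adjoint_def mat_of_rows_def)

lemma mat_adjoint_carrier:
  "M \<in> carrier_mat n m \<Longrightarrow> mat_adjoint M \<in> carrier_mat m n"
  by (auto simp: mat_adjoint_def)

lemma mat_adjoint_mult:
  fixes A B :: "complex mat"
  assumes "A \<in> carrier_mat n m" "B \<in> carrier_mat m k"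
  shows "mat_adjoint (A * B) = mat_adjoint B * mat_adjoint A"
proof (rule eq_matI)
  note c = mat_adjoint_carrier[OF assms(1)] mat_adjoint_carrier[OF assms(2)]
    mat_adjoint_carrier[OF mult_carrier_mat[OF assms]]
  show "dim_row (mat_adjoint (A * B)) = dim_row (mat_adjoint B * mat_adjoint A)"
    "dim_col (mat_adjoint (A * B)) = dim_col (mat_adjoint B * mat_adjoint A)"
    using c by auto
  fix i j assume "i < dim_row (mat_adjoint B * mat_adjoint A)"
    "j < dim_col (mat_adjoint B * mat_adjoint A)"
  then have "i < k" "j < n" using c by auto
  with assms c show "mat_adjoint (A * B) $$ (i, j) = (mat_adjoint B * mat_adjoint A) $$ (i, j)"
    by (simp add: mat_adjoint_index scalar_prod_def mult.commute)
qed

lemma mat_adjoint_adjoint: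
  fixes A :: "complex mat"
  assumes "A \<in> carrier_mat n m"
  shows "mat_adjoint (mat_adjoint A) = A"
proof (rule eq_matI)
  note c = mat_adjoint_carrier[OF assms] mat_adjoint_carrier[OF mat_adjoint_carrier[OF assms]]
  show "dim_row (mat_adjoint (mat_adjoint A)) = dim_row A"
    "dim_col (mat_adjoint (mat_adjoint A)) = dim_col A"
    using c assms by auto
  fix i j assume "i < dim_row A" "j < dim_col A"
  with assms c show "mat_adjoint (mat_adjoint A) $$ (i, j) = A $$ (i, j)"
    by (simp add: mat_adjoint_index)
qed

lemma mat_adjoint_one: "mat_adjoint (1\<^sub>m n :: complex mat) = 1\<^sub>m n"
  by (rule eq_matI) (use mat_adjoint_carrier[OF one_carrier_mat[of n]] in
      \<open>auto simp: mat_adjoint_index\<close>)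

lemma mat_adjoint_in_unitary_group:
  assumes "M \<in> carrier (unitary_group n)"
  shows "mat_adjoint M \<in> carrier (unitary_group n)"
proof -
  have M: "M \<in> carrier_mat n n" "mat_adjoint M * M = 1\<^sub>m n"
    using assms by (auto simp: unitary_group_def)
  have "M * mat_adjoint M = 1\<^sub>m n"
    using mat_mult_left_right_inverse[OF mat_adjoint_carrier[OF M(1)] M(1) M(2)] .
  with M show ?thesis
    by (simp add: unitary_group_def mat_adjoint_carrier mat_adjoint_adjoint)
qed

lemma group_unitary_group: "group (unitary_group n)"
proof (rule groupI)
  fix x y assume "x \<in> carrier (unitary_group n)" "y \<in> carrier (unitary_group n)"
  then have x: "x \<in> carrier_mat n n" "mat_adjoint x * x = 1\<^sub>m n"
    and y: "y \<in> carrier_mat n n" "mat_adjoint y * y = 1\<^sub>m n"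
    by (auto simp: unitary_group_def)
  note c = mat_adjoint_carrier[OF x(1)] mat_adjoint_carrier[OF y(1)]
  have "mat_adjoint (x * y) * (x * y) = mat_adjoint y * (mat_adjoint x * (x * y))"
    using x y c by (simp add: mat_adjoint_mult assoc_mult_mat[of _ n n _ n _ n])
  also have "mat_adjoint x * (x * y) = y"
    using x y c by (simp add: assoc_mult_mat[of _ n n _ n _ n, symmetric])
  finally show "x \<otimes>\<^bsub>unitary_group n\<^esub> y \<in> carrier (unitary_group n)"
    using x y by (simp add: unitary_group_def)
next
  show "\<one>\<^bsub>unitary_group n\<^esub> \<in> carrier (unitary_group n)"
    by (simp add: unitary_group_def mat_adjoint_one)
next
  fix x assume x: "x \<in> carrier (unitary_group n)"
  show "\<exists>y\<in>carrier (unitary_group n). y \<otimes>\<^bsub>unitary_group n\<^esub> x = \<one>\<^bsub>unitary_group n\<^esub>"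
    using mat_adjoint_in_unitary_group[OF x] x by (auto simp: unitary_group_def)
qed (auto simp: unitary_group_def)

lemma inv_unitary_group:
  assumes "M \<in> carrier (unitary_group n)"
  shows "inv\<^bsub>unitary_group n\<^esub> M = mat_adjoint M"
  by (rule group.inv_equality[OF group_unitary_group])
    (use assms mat_adjoint_in_unitary_group[OF assms] in \<open>auto simp: unitary_group_def\<close>)

end

theory Submission
  imports Defs "Jordan_Normal_Form.Spectral_Radius"
begin

text \<open>
  Write $W_m$ for the set of $m$-fold products of elements of $A$; by Ruzsa's inequality
  $|W_{m+1}| \le K^m |A|$. The closed subgroups considered are the unitary parts of centralisers:
  $H = \mathrm{U}_n \cap \Gamma'$ for a set $\Gamma$ of commuting unitaries, with centre $\mathrm{U}_n \cap \Gamma''$.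

  As in Jordan's theorem, pick $\gamma \in W_2 \cap H$ outside $\Gamma''$, close to $1$, with
  $\|\gamma - 1\|$ minimal in Frobenius norm. If $a, b \in W_4 \cap H$ are close to $1$ and
  $q = [\gamma, a]^{-1} [\gamma, b]$ lies in $W_2$, then $q$ is closer to $1$ than $\gamma$ and hence lies in
  $\Gamma''$; this makes $\gamma$ conjugate to $\gamma q^{-1}$, and a trace computation gives $q = 1$. So there are
  at most $K^{12}$ commutators $[\gamma, a]$, and a large part of $W_2 \cap H$ commutes with $\gamma$. Adding $\gamma$
  to $\Gamma$ and repeating, one reaches after at most $n$ steps an abelian $S = \mathrm{U}_n \cap X'$ with
  $|W_2 \cap S| \ge |A| / D$ where $D = n^{O(n^3)} K^{O(n)}$.

  If $|W_2 \cap S|$ and $|W_2 \cap T|$ are large then so is $|W_2 \cap S \cap T|$. Intersecting $S$ with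
  conjugates of itself by short words, one reaches after at most $n$ steps a subgroup normalised by $A$,
  at the cost of a factor $D K^{O(n)}$ per step. In both stages the number of steps is bounded because a
  strictly monotone chain of centralisers of commuting unitaries refines a decomposition of
  $\mathbb{C}^n$ into joint eigenspaces. All these groups are connected: if $u$ lies in one,
  so does the path $u^t$ defined by functional calculus.
\<close>

section \<open>Small tripling\<close>

lemma card_le_fibres:
  assumes "finite A" "finite B" "f ` A \<subseteq> B" "\<And>y. y \<in> B \<Longrightarrow> card {x\<in>A. f x = y} \<le> k"
  shows "card A \<le> k * card B"
proof -
  have "card A = card (\<Union>y\<in>B. {x\<in>A. f x = y})"
    using assms(3) by (intro arg_cong[of _ _ card]) auto
  also have "\<dots> \<le> (\<Sum>y\<in>B. card {x\<in>A. f x = y})"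
    by (rule card_UN_le[OF assms(2)])
  also have "\<dots> \<le> (\<Sum>y\<in>B. k)" by (rule sum_mono) (rule assms(4))
  finally show ?thesis by (simp add: mult.commute)
qed

primrec word_set :: "('a, 'b) monoid_scheme \<Rightarrow> 'a set \<Rightarrow> nat \<Rightarrow> 'a set" where
  "word_set G A 0 = {\<one>\<^bsub>G\<^esub>}"
| "word_set G A (Suc m) = A <#>\<^bsub>G\<^esub> word_set G A m"

declare word_set.simps(2) [simp del]

lemma finite_set_mult: "finite A \<Longrightarrow> finite B \<Longrightarrow> finite (A <#>\<^bsub>G\<^esub> B)"
  by (simp add: set_mult_def)

text \<open>Left translation by the inverse of a first component embeds a fibre of the multiplication
  $P \times B \to R$ into $Q$.\<close>
lemma (in group) card_mult_le:
  assumes P: "P \<subseteq> carrier G" "finite P" and B: "B \<subseteq> carrier G" "finite B" and Q: "finite Q" and R: "finite R"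
    and PB: "\<And>p b. p \<in> P \<Longrightarrow> b \<in> B \<Longrightarrow> p \<otimes> b \<in> R"
    and PQ: "\<And>p p' b b'. p \<in> P \<Longrightarrow> p' \<in> P \<Longrightarrow> b \<in> B \<Longrightarrow> b' \<in> B \<Longrightarrow> inv p \<otimes> p' = b \<otimes> inv b' \<Longrightarrow>
      inv p \<otimes> p' \<in> Q"
  shows "card P * card B \<le> card Q * card R"
proof -
  have "card (P \<times> B) \<le> card Q * card R"
  proof (rule card_le_fibres[where f = "\<lambda>(p, b). p \<otimes> b"])
    fix y assume "y \<in> R"
    let ?F = "{x \<in> P \<times> B. (case x of (p, b) \<Rightarrow> p \<otimes> b) = y}"
    show "card ?F \<le> card Q"
    proof (cases "?F = {}")
      case False
      then obtain p0 b0 where p0: "p0 \<in> P" "b0 \<in> B" "p0 \<otimes> b0 = y" by auto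
      have "inj_on (\<lambda>(p, b). inv p0 \<otimes> p) ?F"
      proof (rule inj_onI)
        fix x x' assume h: "x \<in> ?F" "x' \<in> ?F"
          and eq: "(case x of (p, b) \<Rightarrow> inv p0 \<otimes> p) = (case x' of (p, b) \<Rightarrow> inv p0 \<otimes> p)"
        obtain p b p' b' where x: "x = (p, b)" "x' = (p', b')" by fastforce
        have c: "p \<in> carrier G" "b \<in> carrier G" "p' \<in> carrier G" "b' \<in> carrier G" "p0 \<in> carrier G"
          using h x p0 P B by auto
        have "p = p'" using eq c x by simp
        moreover have "p \<otimes> b = p' \<otimes> b'" using h x by simp
        ultimately show "x = x'" using c x by simp
      qed
      moreover have "(\<lambda>(p, b). inv p0 \<otimes> p) ` ?F \<subseteq> Q"
      proof
        fix z assume "z \<in> (\<lambda>(p, b). inv p0 \<otimes> p) ` ?F"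
        then obtain p b where h: "z = inv p0 \<otimes> p" "p \<in> P" "b \<in> B" "p \<otimes> b = y" by auto
        have c: "p \<in> carrier G" "b \<in> carrier G" "p0 \<in> carrier G" "b0 \<in> carrier G"
          using h p0 P B by auto
        have "p = p0 \<otimes> b0 \<otimes> inv b" using c h p0 by (metis inv_solve_right m_closed)
        then have "inv p0 \<otimes> p = b0 \<otimes> inv b" using c by (simp add: m_assoc inv_solve_left')
        then show "z \<in> Q" using PQ[OF p0(1) h(2) p0(2) h(3)] h(1) by simp
      qed
      ultimately show ?thesis using card_inj_on_le Q by blast
    next
      case True
      then show ?thesis by (simp only: card.empty le0)
    qed
  qed (use P B R PB in auto)
  then show ?thesis by (simp add: card_cartesian_product)
qed

text \<open>The counting arguments hold in an arbitrary group. Nonemptiness of \<open>A\<close>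
  allows factors \<open>card A\<close> to be cancelled; symmetry keeps inverses of words among words
  of the same length.\<close>

locale small_tripling = group G for G (structure) +
  fixes A :: "'a set" and K :: real
  assumes finite_A: "finite A" and A_carrier: "A \<subseteq> carrier G" and A_ne: "A \<noteq> {}"
    and A_inv: "\<And>a. a \<in> A \<Longrightarrow> inv a \<in> A" and K_ge_1: "K \<ge> 1"
    and tripling: "real (card (A <#> A <#> A)) \<le> K * real (card A)"
begin

abbreviation W :: "nat \<Rightarrow> 'a set" where "W m \<equiv> word_set G A m"

lemma W_carrier: "W m \<subseteq> carrier G"
  by (induction m) (use A_carrier in \<open>auto simp: set_mult_def word_set.simps(2)\<close>)

lemma W_in_carrier: "x \<in> W m \<Longrightarrow> x \<in> carrier G"
  using W_carrier by auto

lemma finite_W: "finite (W m)"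
  by (induction m) (auto simp: finite_set_mult finite_A word_set.simps(2))

lemma W_1: "W (Suc 0) = A"
  using A_carrier by (force simp: set_mult_def word_set.simps(2))

lemma W_add: "W (k + m) = W k <#> W m"
proof (induction k)
  case 0
  show ?case using W_carrier[of m] by (force simp: set_mult_def)
next
  case (Suc k)
  then show ?case by (simp add: set_mult_assoc W_carrier A_carrier word_set.simps(2))
qed

lemma W_mult: "x \<in> W k \<Longrightarrow> y \<in> W m \<Longrightarrow> x \<otimes> y \<in> W (k + m)"
  unfolding W_add by (auto simp: set_mult_def)

lemma W_inv: "x \<in> W m \<Longrightarrow> inv x \<in> W m"
proof (induction m arbitrary: x)
  case (Suc m)
  then obtain a y where ay: "a \<in> A" "y \<in> W m" "x = a \<otimes> y" by (auto simp: set_mult_def word_set.simps(2))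
  then have "inv x = inv y \<otimes> inv a"
    using A_carrier W_in_carrier by (auto simp: inv_mult_group)
  then show ?case using W_mult[of "inv y" m "inv a" "Suc 0"] Suc.IH ay A_inv by (simp add: W_1)
qed auto

lemma W_3: "A <#> A <#> A = W 3"
  using W_1 by (simp add: numeral_3_eq_3 word_set.simps(2) set_mult_assoc A_carrier)

lemma card_A_pos: "card A > 0"
  using finite_A A_ne by (simp add: card_gt_0_iff)

text \<open>Fix a factorisation \<open>y = u y \<otimes> v y\<close> of each word, with
  \<open>u y\<close> of length \<open>m + 1\<close> and \<open>v y\<close> of length 2. Sending
  \<open>(y, a)\<close> to the pair of \<open>u y \<otimes> a\<close> and
  \<open>inv a \<otimes> v y\<close> is injective: the product of the two components recovers
  \<open>y\<close>, and then the first one recovers \<open>a\<close>.\<close>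

lemma ruzsa_triangle: "card (W (m + 3)) * card A \<le> card (W (m + 2)) * card (W 3)"
proof -
  have "\<forall>y\<in>W (m + 3). \<exists>uv. fst uv \<in> W (m + 1) \<and> snd uv \<in> W 2 \<and> y = fst uv \<otimes> snd uv"
  proof
    fix y assume "y \<in> W (m + 3)"
    then have "y \<in> W (m + 1) <#> W 2" unfolding W_add[of "m + 1" 2, symmetric] by (simp add: add.assoc eval_nat_numeral)
    then obtain u v where "u \<in> W (m + 1)" "v \<in> W 2" "y = u \<otimes> v" unfolding set_mult_def by blast
    then show "\<exists>uv. fst uv \<in> W (m + 1) \<and> snd uv \<in> W 2 \<and> y = fst uv \<otimes> snd uv" by (intro exI[of _ "(u, v)"]) simp
  qed
  then obtain d where d: "\<forall>y\<in>W (m + 3). fst (d y) \<in> W (m + 1) \<and> snd (d y) \<in> W 2 \<and> y = fst (d y) \<otimes> snd (d y)"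
    unfolding bchoice_iff by blast
  define u v where "u y = fst (d y)" and "v y = snd (d y)" for y
  have u: "u y \<in> W (m + 1)" and v: "v y \<in> W 2" and uv: "u y \<otimes> v y = y" if "y \<in> W (m + 3)" for y
    using bspec[OF d that] unfolding u_def v_def by simp_all
  let ?f = "\<lambda>(y, a). (u y \<otimes> a, inv a \<otimes> v y)"
  have c: "u y \<in> carrier G" "v y \<in> carrier G" if "y \<in> W (m + 3)" for y
    using u[OF that] v[OF that] W_in_carrier by auto
  have prod: "u y \<otimes> a \<otimes> (inv a \<otimes> v y) = y" if "y \<in> W (m + 3)" "a \<in> A" for y a
  proof -
    have a: "a \<in> carrier G" using that A_carrier by auto
    have "u y \<otimes> a \<otimes> (inv a \<otimes> v y) = u y \<otimes> (a \<otimes> inv a) \<otimes> v y"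
      using a c[OF that(1)] by (simp only: m_assoc m_closed inv_closed)
    then show ?thesis using a c[OF that(1)] uv[OF that(1)] by simp
  qed
  have inj: "inj_on ?f (W (m + 3) \<times> A)"
  proof (rule inj_onI, clarify)
    fix y a y' a'
    assume h: "y \<in> W (m + 3)" "a \<in> A" "y' \<in> W (m + 3)" "a' \<in> A"
      "u y \<otimes> a = u y' \<otimes> a'" "inv a \<otimes> v y = inv a' \<otimes> v y'"
    have yy: "y = y'" using prod[OF h(1,2)] prod[OF h(3,4)] h(5,6) by metis
    have "a \<in> carrier G" "a' \<in> carrier G" using h A_carrier by auto
    then show "y = y' \<and> a = a'" using h(5) c[OF h(3)] unfolding yy by simp
  qed
  have "?f ` (W (m + 3) \<times> A) \<subseteq> W (m + 2) \<times> W 3"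
  proof (rule image_subsetI, clarify)
    fix y a assume h: "y \<in> W (m + 3)" "a \<in> A"
    have "u y \<otimes> a \<in> W (m + 2)"
      using W_mult[OF u[OF h(1)], of a "Suc 0"] h(2) by (simp add: W_1)
    moreover have "inv a \<otimes> v y \<in> W 3"
      using W_mult[of "inv a" "Suc 0" "v y" 2] v[OF h(1)] A_inv[OF h(2)]
      by (simp add: W_1 eval_nat_numeral)
    ultimately show "u y \<otimes> a \<in> W (m + 2) \<and> inv a \<otimes> v y \<in> W 3" ..
  qed
  from card_inj_on_le[OF inj this] show ?thesis
    by (simp add: card_cartesian_product finite_W)
qed

text \<open>Each use of \<open>ruzsa_triangle\<close> lengthens the words by one and costs one
  factor \<open>K\<close>.\<close>

lemma card_W: "real (card (W (Suc m))) \<le> K ^ m * real (card A)"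
proof (induction m)
  case (Suc m)
  show ?case
  proof (cases m)
    case 0
    \<comment> \<open>Words have exactly the prescribed length, so \<open>W 2\<close> need not lie
      in \<open>W 3\<close>; a translate by an element of \<open>A\<close> does.\<close>
    obtain a where a: "a \<in> A" using A_ne by auto
    have "inj_on (\<lambda>y. a \<otimes> y) (W 2)"
      using a A_carrier W_in_carrier by (auto simp: inj_on_def)
    moreover have "(\<lambda>y. a \<otimes> y) ` W 2 \<subseteq> W 3"
      using a by (auto simp: numeral_3_eq_3 numeral_2_eq_2 set_mult_def word_set.simps(2))
    ultimately have "card (W 2) \<le> card (W 3)" using card_inj_on_le finite_W by blast
    then show ?thesis using tripling 0 by (simp add: W_3 numeral_2_eq_2)
  next
    case (Suc k)
    have "real (card (W (Suc (Suc m)))) * real (card A) \<le> real (card (W (Suc m))) * real (card (W 3))"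
      using ruzsa_triangle[of k] Suc unfolding of_nat_mult[symmetric] of_nat_le_iff
      by (simp add: numeral_3_eq_3 numeral_2_eq_2)
    also have "\<dots> \<le> (K ^ m * real (card A)) * (K * real (card A))"
      using Suc.IH tripling K_ge_1 by (intro mult_mono) (auto simp: W_3)
    finally show ?thesis using card_A_pos by (simp add: mult_ac)
  qed
qed (simp add: W_1)

text \<open>Count the products of \<open>P\<close> with \<open>A\<close>, all of which lie in
  \<open>W (Suc m)\<close>. If two products coincide, the quotient of their first factors is a
  quotient of elements of \<open>A\<close>, hence in \<open>W 2\<close>. So the quotients of
  \<open>P\<close> need to be controlled only when they are short.\<close>

lemma packing:
  assumes P: "P \<subseteq> W m" and Q: "finite Q"
    and PQ: "\<And>p p'. p \<in> P \<Longrightarrow> p' \<in> P \<Longrightarrow> inv p \<otimes> p' \<in> W 2 \<Longrightarrow> inv p \<otimes> p' \<in> Q"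
  shows "real (card P) \<le> K ^ m * real (card Q)"
proof -
  have "card P * card A \<le> card Q * card (W (Suc m))"
  proof (rule card_mult_le)
    show "p \<otimes> a \<in> W (Suc m)" if "p \<in> P" "a \<in> A" for p a
      using P that W_mult[of p m a "Suc 0"] by (auto simp: W_1)
    fix p p' a a'
    assume h: "p \<in> P" "p' \<in> P" "a \<in> A" "a' \<in> A" "inv p \<otimes> p' = a \<otimes> inv a'"
    then show "inv p \<otimes> p' \<in> Q"
      using PQ[OF h(1,2)] W_mult[of a "Suc 0" "inv a'" "Suc 0"] A_inv by (simp add: W_1 numeral_2_eq_2)
  qed (use P Q finite_A finite_W W_carrier A_carrier finite_subset in blast)+
  then have "real (card P) * real (card A) \<le> real (card Q) * real (card (W (Suc m)))"
    unfolding of_nat_mult[symmetric] of_nat_le_iff by simp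
  also have "\<dots> \<le> real (card Q) * (K ^ m * real (card A))"
    by (rule mult_left_mono[OF card_W]) simp
  finally show ?thesis using card_A_pos by (simp add: mult_ac)
qed

text \<open>Packing with \<open>P = W m \<inter> H\<close>. This returns long words of a subgroup to
  the standard length 2 whenever a construction has lengthened them.\<close>

lemma card_W_subgroup:
  assumes "subgroup H G"
  shows "real (card (W m \<inter> H)) \<le> K ^ m * real (card (W 2 \<inter> H))"
  by (rule packing) (use assms finite_W in \<open>auto simp: subgroup.m_closed subgroup.m_inv_closed\<close>)

text \<open>Multiply \<open>W 2 \<inter> T\<close> by \<open>W 2 \<inter> S\<close> inside
  \<open>W 4\<close>. Within a fibre, the quotient of two first factors lies in \<open>T\<close> and
  equals a quotient of second factors, so it lies in \<open>S\<close> too. The exponent is 7 = 4 +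
  3: 4 for shortening words of length 4 in \<open>T \<inter> S\<close>, 3 for the size of
  \<open>W 4\<close>.\<close>

lemma card_W_inter:
  assumes S: "subgroup S G" and T: "subgroup T G"
  shows "real (card (W 2 \<inter> T)) * real (card (W 2 \<inter> S)) \<le> K ^ 7 * real (card A) * real (card (W 2 \<inter> (T \<inter> S)))"
proof -
  have "card (W 2 \<inter> T) * card (W 2 \<inter> S) \<le> card (W 4 \<inter> (T \<inter> S)) * card (W 4)"
  proof (rule card_mult_le)
    show "p \<otimes> a \<in> W 4" if "p \<in> W 2 \<inter> T" "a \<in> W 2 \<inter> S" for p a
      using that W_mult[of p 2 a 2] by auto
    fix p p' a a'
    assume h: "p \<in> W 2 \<inter> T" "p' \<in> W 2 \<inter> T" "a \<in> W 2 \<inter> S" "a' \<in> W 2 \<inter> S" "inv p \<otimes> p' = a \<otimes> inv a'"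
    have "a \<otimes> inv a' \<in> S" using h S by (simp add: subgroup.m_closed subgroup.m_inv_closed)
    moreover have "inv p \<otimes> p' \<in> T" using h(1,2) T by (simp add: subgroup.m_closed subgroup.m_inv_closed)
    moreover have "inv p \<otimes> p' \<in> W 4"
      using W_mult[of "inv p" 2 p' 2] W_inv[of p 2] h by simp
    ultimately show "inv p \<otimes> p' \<in> W 4 \<inter> (T \<inter> S)" using h(5) by auto
  qed (use finite_W W_carrier in blast)+
  then have "real (card (W 2 \<inter> T)) * real (card (W 2 \<inter> S)) \<le> real (card (W 4 \<inter> (T \<inter> S))) * real (card (W (Suc 3)))"
    unfolding of_nat_mult[symmetric] of_nat_le_iff by simp
  also have "\<dots> \<le> (K ^ 4 * real (card (W 2 \<inter> (T \<inter> S)))) * (K ^ 3 * real (card A))"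
    using K_ge_1 by (intro mult_mono card_W card_W_subgroup subgroups_Inter_pair S T) auto
  also have "\<dots> = K ^ 7 * real (card A) * real (card (W 2 \<inter> (T \<inter> S)))"
    by (simp add: algebra_simps flip: power_add mult.assoc)
  finally show ?thesis .
qed

text \<open>With one representative from \<open>A\<close> per coset, the products of
  \<open>W 2 \<inter> T\<close> with the representatives are pairwise distinct elements of
  \<open>W 3\<close>.\<close>

lemma card_cosets:
  assumes T: "subgroup T G"
  shows "real (card ((\<lambda>a. T #> a) ` A)) * real (card (W 2 \<inter> T)) \<le> K * real (card A)"
proof -
  let ?r = "\<lambda>C. SOME a. a \<in> A \<and> T #> a = C"
  have r: "?r C \<in> A" "T #> ?r C = C" if "C \<in> (\<lambda>a. T #> a) ` A" for C
    using someI_ex[of "\<lambda>a. a \<in> A \<and> T #> a = C"] that by auto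
  have "inj_on (\<lambda>(C, t). t \<otimes> ?r C) (((\<lambda>a. T #> a) ` A) \<times> (W 2 \<inter> T))"
  proof (rule inj_onI, clarsimp)
    fix t t' a a' assume h: "t \<in> W 2" "t \<in> T" "t' \<in> W 2" "t' \<in> T" "a \<in> A" "a' \<in> A"
      and eq: "t \<otimes> ?r (T #> a) = t' \<otimes> ?r (T #> a')"
    note r1 = r[OF imageI[OF h(5)]] and r2 = r[OF imageI[OF h(6)]]
    have TC: "T \<subseteq> carrier G" using T by (rule subgroup.subset)
    have c: "?r (T #> a) \<in> carrier G" "?r (T #> a') \<in> carrier G" "t \<in> carrier G" "t' \<in> carrier G"
      using r1 r2 A_carrier h W_in_carrier by auto
    have "T #> a = T #> (t \<otimes> ?r (T #> a))"
      using r1(2) coset_mult_assoc[OF TC c(3,1)] coset_join2[OF c(3) T h(2)] by simp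
    also have "\<dots> = T #> a'"
      unfolding eq using r2(2) coset_mult_assoc[OF TC c(4,2)] coset_join2[OF c(4) T h(4)] by simp
    finally show "T #> a = T #> a' \<and> t = t'" using eq c by simp
  qed
  moreover have "(\<lambda>(C, t). t \<otimes> ?r C) ` (((\<lambda>a. T #> a) ` A) \<times> (W 2 \<inter> T)) \<subseteq> W 3"
    using r(1) W_mult[of _ 2 _ "Suc 0"] by (auto simp: W_1 numeral_3_eq_3)
  ultimately have "card (((\<lambda>a. T #> a) ` A) \<times> (W 2 \<inter> T)) \<le> card (W 3)"
    by (rule card_inj_on_le) (rule finite_W)
  then have "real (card ((\<lambda>a. T #> a) ` A)) * real (card (W 2 \<inter> T)) \<le> real (card (W 3))"
    unfolding of_nat_mult[symmetric] of_nat_le_iff by (simp only: card_cartesian_product)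
  then show ?thesis using tripling unfolding W_3 by linarith
qed

end

section \<open>Diagonalisation of unitary matrices\<close>

lemma mult_index:
  assumes "M \<in> carrier_mat n m" "N \<in> carrier_mat m k" "i < n" "j < k"
  shows "(M * N) $$ (i, j) = (\<Sum>l<m. M $$ (i, l) * N $$ (l, j))"
  using assms by (auto simp: scalar_prod_def lessThan_atLeast0)

lemma square_mult_carrier: "M \<in> carrier_mat n n \<Longrightarrow> N \<in> carrier_mat n n \<Longrightarrow> M * N \<in> carrier_mat n n"
  by (rule mult_carrier_mat)

lemma adjoint_mult_index:
  fixes M N :: "complex mat"
  assumes "M \<in> carrier_mat m n" "N \<in> carrier_mat m k" "i < n" "j < k"
  shows "(mat_adjoint M * N) $$ (i, j) = (\<Sum>l<m. cnj (M $$ (l, i)) * N $$ (l, j))"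
  using assms by (subst mult_index[OF mat_adjoint_carrier[OF assms(1)] assms(2-4)])
    (auto simp: mat_adjoint_index)

lemma unitaryD:
  assumes "u \<in> carrier (unitary_group n)"
  shows "u \<in> carrier_mat n n" "mat_adjoint u * u = 1\<^sub>m n" "u * mat_adjoint u = 1\<^sub>m n"
    "mat_adjoint u \<in> carrier_mat n n"
proof -
  show u: "u \<in> carrier_mat n n" "mat_adjoint u * u = 1\<^sub>m n" "mat_adjoint u \<in> carrier_mat n n"
    using assms mat_adjoint_carrier by (auto simp: unitary_group_def)
  show "u * mat_adjoint u = 1\<^sub>m n"
    by (rule mat_mult_left_right_inverse[OF u(3,1,2)])
qed

lemma unitaryI: "u \<in> carrier_mat n n \<Longrightarrow> mat_adjoint u * u = 1\<^sub>m n \<Longrightarrow> u \<in> carrier (unitary_group n)"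
  by (simp add: unitary_group_def)

lemma unitary_mult: "u \<in> carrier (unitary_group n) \<Longrightarrow> v \<in> carrier (unitary_group n) \<Longrightarrow> u * v \<in> carrier (unitary_group n)"
  using group.is_monoid[OF group_unitary_group, THEN monoid.m_closed, of u n v] by (simp add: unitary_group_def)

lemma unitary_cancel:
  assumes "u \<in> carrier (unitary_group n)" "x \<in> carrier_mat n m"
  shows "mat_adjoint u * (u * x) = x" "u * (mat_adjoint u * x) = x"
  using unitaryD[OF assms(1)] assms(2) by (simp_all add: assoc_mult_mat[symmetric, of _ n n _ n _ m])

text \<open>Complete \<open>v\<close> to a basis and orthogonalise by Gram-Schmidt, which keeps
  \<open>v\<close> in first place; then normalise the columns. Thus \<open>c\<close> is the
  reciprocal of the norm of \<open>v\<close>.\<close>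

lemma ex_unitary_first_column:
  fixes v :: "complex vec"
  assumes v: "v \<in> carrier_vec n" "v \<noteq> 0\<^sub>v n"
  obtains W c where "W \<in> carrier (unitary_group n)" "\<And>i. i < n \<Longrightarrow> W $$ (i, 0) = c * v $ i"
proof -
  interpret cof_vec_space n "TYPE(complex)" .
  define ws where "ws = gram_schmidt n (basis_completion v)"
  note bc = basis_completion[OF v]
  have n: "0 < n" using v by (cases n) auto
  have ws: "set ws \<subseteq> carrier_vec n" "corthogonal ws" "length ws = n"
    using gram_schmidt_result[OF bc(2,4,5) ws_def] bc(6) by auto
  have "hd ws = v"
    using gram_schmidt_hd[OF v(1), of "tl (basis_completion v)"] bc(6,7) n
    unfolding ws_def by (cases "basis_completion v") auto
  then have ws0: "ws ! 0 = v" using ws(3) n by (cases ws) auto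
  define s where "s j = (\<Sum>l<n. (cmod (ws ! j $ l))\<^sup>2)" for j
  have wsc: "ws ! j \<in> carrier_vec n" if "j < n" for j using ws that by auto
  have ip: "(\<Sum>l<n. cnj (ws ! i $ l) * ws ! j $ l) = (if i = j then of_real (s j) else 0)"
    and spos: "s j > 0" if "i < n" "j < n" for i j
  proof -
    have e: "ws ! j \<bullet>c ws ! i = (\<Sum>l<n. cnj (ws ! i $ l) * ws ! j $ l)" if "i < n" "j < n" for i j
      using wsc[OF that(1)] wsc[OF that(2)]
      by (auto simp: scalar_prod_def lessThan_atLeast0 mult.commute intro!: sum.cong)
    have d: "(\<Sum>l<n. cnj (ws ! j $ l) * ws ! j $ l) = of_real (s j)" for j
      by (simp add: s_def mult.commute flip: complex_norm_square)
    have "s j \<noteq> 0" using corthogonalD[OF ws(2), of j j] that e[of j j] d[of j] ws(3) by auto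
    then show "s j > 0" using sum_nonneg[of "{..<n}" "\<lambda>l. (cmod (ws ! j $ l))\<^sup>2"] by (simp add: s_def order_less_le)
    show "(\<Sum>l<n. cnj (ws ! i $ l) * ws ! j $ l) = (if i = j then of_real (s j) else 0)"
      using corthogonalD[OF ws(2), of j i] that e[of i j] d[of j] ws(3) by auto
  qed
  define W where "W = Matrix.mat n n (\<lambda>(i, j). ws ! j $ i / of_real (sqrt (s j)))"
  have Wc: "W \<in> carrier_mat n n" by (simp add: W_def)
  have "mat_adjoint W * W = 1\<^sub>m n"
  proof (rule eq_matI)
    fix i j assume "i < dim_row (1\<^sub>m n :: complex mat)" "j < dim_col (1\<^sub>m n :: complex mat)"
    then have ij: "i < n" "j < n" by auto
    have "(mat_adjoint W * W) $$ (i, j) = (\<Sum>l<n. cnj (W $$ (l, i)) * W $$ (l, j))"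
      by (rule adjoint_mult_index[OF Wc Wc ij])
    also have "\<dots> = (\<Sum>l<n. cnj (ws ! i $ l) * ws ! j $ l) / (of_real (sqrt (s i)) * of_real (sqrt (s j)))"
      using ij by (simp add: W_def sum_divide_distrib)
    also have "\<dots> = (1\<^sub>m n :: complex mat) $$ (i, j)"
      using ij spos[OF ij] by (simp add: ip flip: of_real_mult)
    finally show "(mat_adjoint W * W) $$ (i, j) = 1\<^sub>m n $$ (i, j)" .
  qed (use Wc mat_adjoint_carrier[OF Wc] in auto)
  then have "W \<in> carrier (unitary_group n)" by (rule unitaryI[OF Wc])
  moreover have "W $$ (i, 0) = (1 / of_real (sqrt (s 0))) * v $ i" if "i < n" for i
    using that n by (simp add: W_def ws0)
  ultimately show thesis by (rule that)
qed

lemma diag_conj_index: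
  fixes V :: "complex mat"
  assumes V: "V \<in> carrier_mat n n" and ij: "i < n" "j < n"
  shows "(V * mat_diag n d * mat_adjoint V) $$ (i, j) = (\<Sum>k<n. V $$ (i, k) * d k * cnj (V $$ (j, k)))"
proof -
  have VD: "V * mat_diag n d = Matrix.mat n n (\<lambda>(i, j). V $$ (i, j) * d j)"
    by (rule mat_diag_mult_right[OF V])
  show ?thesis
    using V ij unfolding VD
    by (subst mult_index[OF _ mat_adjoint_carrier[OF V]]) (auto simp: mat_adjoint_index)
qed

text \<open>Induction on the dimension. A normalised eigenvector becomes the first column of a
  unitary \<open>W\<close>; conjugation by \<open>W\<close> turns \<open>u\<close> into a matrix
  \<open>B\<close> that splits into the eigenvalue \<open>e\<close> and a unitary block of size
  \<open>n\<close>.\<close>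

lemma unitary_diagonalization:
  assumes "u \<in> carrier (unitary_group n)"
  shows "\<exists>V d. V \<in> carrier (unitary_group n) \<and> u = V * mat_diag n d * mat_adjoint V"
  using assms
proof (induction n arbitrary: u)
  case 0
  then have "u = 1\<^sub>m 0" by (auto simp: unitary_group_def)
  moreover have "1\<^sub>m 0 \<in> carrier (unitary_group 0)"
    using monoid.one_closed[OF group.is_monoid[OF group_unitary_group[of 0]]] by (simp add: unitary_group_def)
  ultimately show ?case
    by (intro exI[of _ "1\<^sub>m 0"] exI[of _ "\<lambda>_. 1"]) (auto simp: mat_adjoint_one)
next
  case (Suc n)
  let ?N = "Suc n"
  note u = unitaryD[OF Suc.prems]
  obtain e where "eigenvalue u e"
    using spectrum_non_empty[OF u(1)] unfolding spectrum_def by auto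
  then obtain v where v: "v \<in> carrier_vec ?N" "v \<noteq> 0\<^sub>v ?N" "u *\<^sub>v v = e \<cdot>\<^sub>v v"
    using u(1) unfolding eigenvalue_def eigenvector_def by auto
  obtain W c where W: "W \<in> carrier (unitary_group ?N)" and W0: "\<And>i. i < ?N \<Longrightarrow> W $$ (i, 0) = c * v $ i"
    using ex_unitary_first_column[OF v(1,2)] by blast
  note Wc = unitaryD[OF W]
  define B where "B = mat_adjoint W * u * W"
  have B: "B \<in> carrier (unitary_group ?N)"
    unfolding B_def by (intro unitary_mult mat_adjoint_in_unitary_group W Suc.prems)
  note Bc = unitaryD[OF B]
  have uW0: "(u * W) $$ (i, 0) = e * W $$ (i, 0)" if "i < ?N" for i
  proof -
    have "(u * W) $$ (i, 0) = c * (u *\<^sub>v v) $ i"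
      using that u(1) Wc(1) v(1) W0 
      by (subst mult_index[OF u(1) Wc(1)]) (auto simp: scalar_prod_def lessThan_atLeast0 sum_distrib_left mult_ac intro!: sum.cong
        simp del: sum.lessThan_Suc sum.op_ivl_Suc)
    then show ?thesis using that v W0 by simp
  qed
  have B0: "B $$ (i, 0) = (if i = 0 then e else 0)" if "i < ?N" for i
  proof -
    have "B $$ (i, 0) = (\<Sum>l<?N. cnj (W $$ (l, i)) * (u * W) $$ (l, 0))"
      unfolding B_def assoc_mult_mat[OF Wc(4) u(1) Wc(1)]
      using that by (intro adjoint_mult_index[OF Wc(1)]) (use u Wc in auto)
    also have "\<dots> = e * (\<Sum>l<?N. cnj (W $$ (l, i)) * W $$ (l, 0))"
      using uW0 by (simp add: sum_distrib_left mult_ac del: sum.lessThan_Suc)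
    also have "\<dots> = e * (mat_adjoint W * W) $$ (i, 0)"
      using that by (simp add: adjoint_mult_index[OF Wc(1) Wc(1)] del: sum.lessThan_Suc)
    finally show ?thesis using that Wc(2) by simp
  qed
  have "(mat_adjoint B * B) $$ (0, 0) = (\<Sum>l<?N. cnj (B $$ (l, 0)) * B $$ (l, 0))"
    by (rule adjoint_mult_index[OF Bc(1) Bc(1)]) auto
  then have e1: "cnj e * e = 1"
    using Bc(2) B0 by (simp add: sum.lessThan_Suc_shift del: sum.lessThan_Suc)
  \<comment> \<open>The first row of \<open>B\<close> is a unit vector and its first entry
    \<open>e\<close> already has modulus 1, so the other entries of that row vanish.\<close>
  have "(B * mat_adjoint B) $$ (0, 0) = (\<Sum>l<?N. B $$ (0, l) * mat_adjoint B $$ (l, 0))"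
    by (rule mult_index[OF Bc(1) Bc(4)]) auto
  also have "\<dots> = (\<Sum>l<?N. of_real ((cmod (B $$ (0, l)))\<^sup>2))"
    using Bc(1) by (intro sum.cong) (auto simp: mat_adjoint_index simp flip: complex_norm_square)
  finally have "(\<Sum>l<?N. of_real ((cmod (B $$ (0, l)))\<^sup>2)) = (1 :: complex)" using Bc(3) by simp
  then have "1 = (\<Sum>l<?N. (cmod (B $$ (0, l)))\<^sup>2)"
    by (simp del: sum.lessThan_Suc of_real_power flip: of_real_sum)
  moreover have "(cmod e)\<^sup>2 = 1" using e1 complex_norm_square[of e] by (metis mult.commute of_real_eq_1_iff)
  ultimately have "(\<Sum>l<n. (cmod (B $$ (0, Suc l)))\<^sup>2) = 0"
    using B0[of 0] by (simp add: sum.lessThan_Suc_shift del: sum.lessThan_Suc)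
  then have Brow: "B $$ (0, Suc l) = 0" if "l < n" for l
    using that by (simp add: sum_nonneg_eq_0_iff)
  define B' where "B' = Matrix.mat n n (\<lambda>(i, j). B $$ (Suc i, Suc j))"
  have B'c: "B' \<in> carrier_mat n n" by (simp add: B'_def)
  have "mat_adjoint B' * B' = 1\<^sub>m n"
  proof (rule eq_matI)
    fix i j assume "i < dim_row (1\<^sub>m n :: complex mat)" "j < dim_col (1\<^sub>m n :: complex mat)"
    then have ij: "i < n" "j < n" by auto
    have "(mat_adjoint B' * B') $$ (i, j) = (\<Sum>l<n. cnj (B $$ (Suc l, Suc i)) * B $$ (Suc l, Suc j))"
      using ij by (subst adjoint_mult_index[OF B'c B'c ij]) (simp add: B'_def)
    also have "\<dots> = (\<Sum>l<?N. cnj (B $$ (l, Suc i)) * B $$ (l, Suc j))"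
      using ij Brow by (simp add: sum.lessThan_Suc_shift del: sum.lessThan_Suc)
    also have "\<dots> = (mat_adjoint B * B) $$ (Suc i, Suc j)"
      using ij by (simp add: adjoint_mult_index[OF Bc(1) Bc(1)] del: sum.lessThan_Suc)
    finally show "(mat_adjoint B' * B') $$ (i, j) = 1\<^sub>m n $$ (i, j)" using Bc(2) ij by simp
  qed (use B'c mat_adjoint_carrier[OF B'c] in auto)
  then obtain V d where V: "V \<in> carrier (unitary_group n)" and B': "B' = V * mat_diag n d * mat_adjoint V"
    using Suc.IH[OF unitaryI[OF B'c]] by blast
  note Vc = unitaryD[OF V]
  \<comment> \<open>The diagonalising matrix of the small block, bordered by a single 1.\<close>
  define V1 where "V1 = Matrix.mat ?N ?N (\<lambda>(i, j). case i of 0 \<Rightarrow> (if j = 0 then 1 else 0) | Suc i' \<Rightarrow>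
    (case j of 0 \<Rightarrow> 0 | Suc j' \<Rightarrow> V $$ (i', j')))"
  define d1 where "d1 = case_nat e d"
  have V1c: "V1 \<in> carrier_mat ?N ?N" by (simp add: V1_def)
  have V1: "V1 \<in> carrier (unitary_group ?N)"
  proof (rule unitaryI[OF V1c], rule eq_matI)
    fix i j assume "i < dim_row (1\<^sub>m ?N :: complex mat)" "j < dim_col (1\<^sub>m ?N :: complex mat)"
    then have ij: "i < ?N" "j < ?N" by auto
    have "(mat_adjoint V1 * V1) $$ (i, j) = (\<Sum>l<?N. cnj (V1 $$ (l, i)) * V1 $$ (l, j))"
      by (rule adjoint_mult_index[OF V1c V1c ij])
    also have "\<dots> = (case i of 0 \<Rightarrow> (if j = 0 then 1 else 0) | Suc i' \<Rightarrow> (case j of 0 \<Rightarrow> 0 | Suc j' \<Rightarrow>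
        (\<Sum>l<n. cnj (V $$ (l, i')) * V $$ (l, j'))))"
      using ij by (auto simp: V1_def sum.lessThan_Suc_shift split: nat.splits simp del: sum.lessThan_Suc)
    also have "\<dots> = (1\<^sub>m ?N :: complex mat) $$ (i, j)"
      using ij by (auto split: nat.splits simp: Vc(2) simp flip: adjoint_mult_index[OF Vc(1) Vc(1)])
    finally show "(mat_adjoint V1 * V1) $$ (i, j) = 1\<^sub>m ?N $$ (i, j)" .
  qed (use V1c mat_adjoint_carrier[OF V1c] in auto)
  have BV: "B = V1 * mat_diag ?N d1 * mat_adjoint V1"
  proof (rule eq_matI)
    fix i j assume "i < dim_row (V1 * mat_diag ?N d1 * mat_adjoint V1)" "j < dim_col (V1 * mat_diag ?N d1 * mat_adjoint V1)"
    then have ij: "i < ?N" "j < ?N" using V1c mat_adjoint_carrier[OF V1c] by auto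
    have "(V1 * mat_diag ?N d1 * mat_adjoint V1) $$ (i, j) = (\<Sum>k<?N. V1 $$ (i, k) * d1 k * cnj (V1 $$ (j, k)))"
      by (rule diag_conj_index[OF V1c ij])
    also have "\<dots> = (case i of 0 \<Rightarrow> (if j = 0 then e else 0) | Suc i' \<Rightarrow> (case j of 0 \<Rightarrow> 0 | Suc j' \<Rightarrow>
        (\<Sum>k<n. V $$ (i', k) * d k * cnj (V $$ (j', k)))))"
      using ij by (auto simp: V1_def d1_def sum.lessThan_Suc_shift split: nat.splits simp del: sum.lessThan_Suc)
    also have "\<dots> = B $$ (i, j)"
      using ij B0 Brow by (cases j) (auto split: nat.splits simp: B'_def simp flip: diag_conj_index[OF Vc(1)] B')
    finally show "B $$ (i, j) = (V1 * mat_diag ?N d1 * mat_adjoint V1) $$ (i, j)" by simp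
  qed (use V1c Bc(1) mat_adjoint_carrier[OF V1c] in auto)
  have D: "mat_diag ?N d1 \<in> carrier_mat ?N ?N" by simp
  note asc = assoc_mult_mat[of _ ?N ?N _ ?N _ ?N] square_mult_carrier[of _ ?N]
  note V1' = unitaryD(4)[OF V1]
  have "u = W * (B * mat_adjoint W)"
    unfolding B_def using u Wc by (simp add: asc unitary_cancel[OF W])
  also have "\<dots> = (W * V1) * mat_diag ?N d1 * mat_adjoint (W * V1)"
    unfolding BV mat_adjoint_mult[OF Wc(1) V1c] using Wc V1c D V1' by (simp add: asc)
  finally show ?case using unitary_mult[OF W V1] by blast
qed

section \<open>Functional calculus f(u) relative to a fixed diagonalisation of u\<close>

definition fun_calc :: "nat \<Rightarrow> complex mat \<Rightarrow> (nat \<Rightarrow> complex) \<Rightarrow> (complex \<Rightarrow> complex) \<Rightarrow> complex mat" where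
  "fun_calc n V d f = V * mat_diag n (\<lambda>i. f (d i)) * mat_adjoint V"

context
  fixes n V d u
  assumes V: "V \<in> carrier (unitary_group n)" and u: "u = V * mat_diag n d * mat_adjoint V"
begin

private lemma Vc: "V \<in> carrier_mat n n" "mat_adjoint V \<in> carrier_mat n n" "mat_adjoint V * V = 1\<^sub>m n" "V * mat_adjoint V = 1\<^sub>m n"
  using unitaryD[OF V] by auto

private lemmas asc = assoc_mult_mat[of _ n n _ n _ n] square_mult_carrier[of _ n]

lemma fun_calc_carrier: "fun_calc n V d f \<in> carrier_mat n n"
  using Vc by (auto simp: fun_calc_def intro!: mult_carrier_mat)

lemma fun_calc_mult: "fun_calc n V d f * fun_calc n V d g = fun_calc n V d (\<lambda>z. f z * g z)"
proof -
  have "fun_calc n V d f * fun_calc n V d g =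
      V * (mat_diag n (\<lambda>i. f (d i)) * (mat_adjoint V * (V * (mat_diag n (\<lambda>i. g (d i)) * mat_adjoint V))))"
    unfolding fun_calc_def using Vc by (simp add: asc)
  also have "\<dots> = V * (mat_diag n (\<lambda>i. f (d i)) * mat_diag n (\<lambda>i. g (d i))) * mat_adjoint V"
    using Vc by (simp add: unitary_cancel[where m = n, OF V] right_mult_one_mat[where nr = n and nc = n] asc del: mat_diag_diag)
  finally show ?thesis by (simp add: fun_calc_def)
qed

lemma fun_calc_index: "i < n \<Longrightarrow> j < n \<Longrightarrow>
    fun_calc n V d f $$ (i, j) = (\<Sum>k<n. V $$ (i, k) * f (d k) * cnj (V $$ (j, k)))"
  unfolding fun_calc_def by (rule diag_conj_index[OF Vc(1)])

lemma fun_calc_adjoint: "mat_adjoint (fun_calc n V d f) = fun_calc n V d (\<lambda>z. cnj (f z))"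
  using fun_calc_carrier[of f] fun_calc_carrier[of "\<lambda>z. cnj (f z)"] mat_adjoint_carrier[OF fun_calc_carrier[of f]]
  by (intro eq_matI) (auto simp: mat_adjoint_index fun_calc_index mult_ac)

lemma fun_calc_one: "fun_calc n V d (\<lambda>_. 1) = 1\<^sub>m n"
  using Vc by (simp add: fun_calc_def)

lemma fun_calc_id: "fun_calc n V d (\<lambda>z. z) = u"
  by (simp add: fun_calc_def u)

lemma fun_calc_smult: "fun_calc n V d (\<lambda>z. c * f z) = c \<cdot>\<^sub>m fun_calc n V d f"
  using fun_calc_carrier[of f] fun_calc_carrier[of "\<lambda>z. c * f z"]
  by (intro eq_matI) (auto simp: fun_calc_index sum_distrib_left mult_ac)

text \<open>In the eigenbasis, commuting with \<open>u\<close> means that an entry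
  \<open>(i, j)\<close> can be nonzero only if \<open>d i = d j\<close>; there
  \<open>f (d i) = f (d j)\<close> as well.\<close>

lemma fun_calc_commute:
  assumes x: "x \<in> carrier_mat n n" and xu: "x * u = u * x"
  shows "x * fun_calc n V d f = fun_calc n V d f * x"
proof -
  let ?D = "\<lambda>f. mat_diag n (\<lambda>i. f (d i))"
  have Dc: "?D f \<in> carrier_mat n n" for f by simp
  define y where "y = mat_adjoint V * x * V"
  have y: "y \<in> carrier_mat n n" unfolding y_def using Vc x by auto
  have xy: "x = V * y * mat_adjoint V" unfolding y_def using Vc x by (simp add: asc unitary_cancel[where m = n, OF V] right_mult_one_mat[where nr = n and nc = n])
  have conj: "V * a * mat_adjoint V * (V * b * mat_adjoint V) = V * (a * b) * mat_adjoint V"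
    if "a \<in> carrier_mat n n" "b \<in> carrier_mat n n" for a b
    using that Vc by (simp add: asc unitary_cancel[where m = n, OF V] right_mult_one_mat[where nr = n and nc = n])
  have unconj: "mat_adjoint V * (V * a * mat_adjoint V) * V = a" if "a \<in> carrier_mat n n" for a
    using that Vc by (simp add: asc unitary_cancel[where m = n, OF V] right_mult_one_mat[where nr = n and nc = n])
  have "V * (y * mat_diag n d) * mat_adjoint V = V * (mat_diag n d * y) * mat_adjoint V"
    using xu y unfolding u by (subst (asm) (1 2) xy) (simp add: conj)
  note h = this
  have "y * mat_diag n d = mat_adjoint V * (V * (y * mat_diag n d) * mat_adjoint V) * V"
    by (rule unconj[symmetric]) (simp add: y square_mult_carrier)
  also have "\<dots> = mat_diag n d * y"
    unfolding h by (rule unconj) (simp add: y square_mult_carrier)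
  finally have yd: "y * mat_diag n d = mat_diag n d * y" .
  have yd': "y $$ (i, j) * d j = d i * y $$ (i, j)" if "i < n" "j < n" for i j
    using arg_cong[OF yd, of "\<lambda>M. M $$ (i, j)"] that
    unfolding mat_diag_mult_left[OF y] mat_diag_mult_right[OF y] by simp
  have "y * ?D f = ?D f * y"
    unfolding mat_diag_mult_left[OF y] mat_diag_mult_right[OF y]
  proof (rule cong_mat)
    fix i j assume "i < n" "j < n"
    then show "(\<lambda>(i, j). y $$ (i, j) * f (d j)) (i, j) = (\<lambda>(i, j). f (d i) * y $$ (i, j)) (i, j)"
      using yd'[of i j] by (cases "y $$ (i, j) = 0") auto
  qed auto
  then show ?thesis unfolding fun_calc_def
    by (subst (1 2) xy) (simp add: conj y)
qed

text \<open>The orthogonal projection onto the eigenspace of \<open>c\<close>; it is zero when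
  \<open>c\<close> is not an eigenvalue.\<close>

abbreviation "eig_proj c \<equiv> fun_calc n V d (\<lambda>z. if z = c then 1 else 0)"

text \<open>The eigenspaces span: column \<open>j\<close> of \<open>y * V\<close> is unchanged by
  the projection belonging to \<open>d j\<close>, so it vanishes if that projection annihilates
  \<open>y\<close>.\<close>

lemma eig_proj_complete:
  assumes y: "y \<in> carrier_mat m n" and yP: "\<And>c. y * eig_proj c = 0\<^sub>m m n"
  shows "y = 0\<^sub>m m n"
proof -
  have yV: "y * V \<in> carrier_mat m n" using y Vc by auto
  have "y * V = 0\<^sub>m m n"
  proof (rule eq_matI)
    fix i j assume "i < dim_row (0\<^sub>m m n :: complex mat)" "j < dim_col (0\<^sub>m m n :: complex mat)"
    then have ij: "i < m" "j < n" by auto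
    let ?P = "mat_diag n (\<lambda>i. if d i = d j then 1 else 0) :: complex mat"
    have "y * V * ?P = y * eig_proj (d j) * V"
      unfolding fun_calc_def using y Vc
      by (simp add: assoc_mult_mat[of _ m n _ n _ n] asc unitary_cancel[where m = n, OF V] right_mult_one_mat[where nr = n and nc = n])
    also have "\<dots> = 0\<^sub>m m n" using yP Vc by simp
    finally have "(y * V * ?P) $$ (i, j) = 0" using ij by simp
    then show "(y * V) $$ (i, j) = 0\<^sub>m m n $$ (i, j)"
      using ij yV unfolding mat_diag_mult_right[OF yV] by simp
  qed (use yV in auto)
  then have "y * V * mat_adjoint V = 0\<^sub>m m n" using Vc by simp
  then show ?thesis using y Vc by (simp add: assoc_mult_mat[of _ m n _ n _ n])
qed

lemma eig_proj_eigen: "u * eig_proj c = c \<cdot>\<^sub>m eig_proj c"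
proof -
  have "u * eig_proj c = fun_calc n V d (\<lambda>z. z * (if z = c then 1 else 0))"
    using fun_calc_mult[of "\<lambda>z. z"] by (simp add: fun_calc_id)
  also have "(\<lambda>z. z * (if z = c then 1 else 0)) = (\<lambda>z. c * (if z = c then 1 else 0))" by auto
  finally show ?thesis by (simp add: fun_calc_smult)
qed

end

section \<open>Trace and squared Frobenius norm \<open>fsq\<close>\<close>

definition mtrace :: "complex mat \<Rightarrow> complex" where
  "mtrace M = (\<Sum>i<dim_row M. M $$ (i, i))"

definition fsq :: "complex mat \<Rightarrow> real" where
  "fsq M = (\<Sum>i<dim_row M. \<Sum>j<dim_col M. (cmod (M $$ (i, j)))\<^sup>2)"

lemma fsq_carrier: "M \<in> carrier_mat n m \<Longrightarrow> fsq M = (\<Sum>i<n. \<Sum>j<m. (cmod (M $$ (i, j)))\<^sup>2)"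
  by (auto simp: fsq_def)

lemma fsq_nonneg: "fsq M \<ge> 0"
  by (auto simp: fsq_def intro!: sum_nonneg)

lemma fsq_eq_0: "M \<in> carrier_mat n m \<Longrightarrow> fsq M = 0 \<Longrightarrow> M = 0\<^sub>m n m"
  by (intro eq_matI) (auto simp: fsq_carrier sum_nonneg_eq_0_iff sum_nonneg)

lemma mtrace_comm:
  assumes "M \<in> carrier_mat n m" "N \<in> carrier_mat m n"
  shows "mtrace (M * N) = mtrace (N * M)"
proof -
  have "mtrace (M * N) = (\<Sum>i<n. \<Sum>l<m. M $$ (i, l) * N $$ (l, i))"
    using assms by (simp add: mtrace_def mult_index[OF assms] del: index_mult_mat(1))
  also have "\<dots> = (\<Sum>l<m. \<Sum>i<n. N $$ (l, i) * M $$ (i, l))"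
    by (subst sum.swap) (simp add: mult.commute)
  also have "\<dots> = mtrace (N * M)"
    using assms by (simp add: mtrace_def mult_index[OF assms(2,1)] del: index_mult_mat(1))
  finally show ?thesis .
qed

lemma mtrace_add: "M \<in> carrier_mat n n \<Longrightarrow> N \<in> carrier_mat n n \<Longrightarrow> mtrace (M + N) = mtrace M + mtrace N"
  by (simp add: mtrace_def sum.distrib)

lemma mtrace_minus: "M \<in> carrier_mat n n \<Longrightarrow> N \<in> carrier_mat n n \<Longrightarrow> mtrace (M - N) = mtrace M - mtrace N"
  by (simp add: mtrace_def sum_subtractf)

lemma mtrace_adjoint_self:
  assumes M: "M \<in> carrier_mat n m"
  shows "mtrace (mat_adjoint M * M) = of_real (fsq M)"
proof -
  have "mtrace (mat_adjoint M * M) = (\<Sum>i<m. \<Sum>l<n. cnj (M $$ (l, i)) * M $$ (l, i))"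
    using M mat_adjoint_carrier[OF M]
    by (simp add: mtrace_def adjoint_mult_index[OF M M] del: index_mult_mat(1))
  also have "\<dots> = of_real (\<Sum>i<m. \<Sum>l<n. (cmod (M $$ (l, i)))\<^sup>2)"
    by (simp add: mult.commute flip: complex_norm_square)
  finally show ?thesis by (simp add: fsq_carrier[OF M] sum.swap[of _ "{..<m}"])
qed

lemma fsq_adjoint: "fsq (mat_adjoint M) = fsq M"
proof -
  have "mat_adjoint M \<in> carrier_mat (dim_col M) (dim_row M)" by (intro mat_adjoint_carrier) auto
  then show ?thesis
    by (simp add: fsq_carrier[of M "dim_row M" "dim_col M"] fsq_carrier mat_adjoint_index sum.swap[of _ "{..<dim_col M}"])
qed

lemma cauchy_schwarz_cmod:
  "(cmod (\<Sum>l<(m::nat). a l * b l))\<^sup>2 \<le> (\<Sum>l<m. (cmod (a l))\<^sup>2) * (\<Sum>l<m. (cmod (b l))\<^sup>2)"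
proof -
  have "cmod (\<Sum>l<m. a l * b l) \<le> (\<Sum>l<m. cmod (a l) * cmod (b l))"
    by (rule order_trans[OF norm_sum]) (simp add: norm_mult)
  then have "(cmod (\<Sum>l<m. a l * b l))\<^sup>2 \<le> (\<Sum>l<m. cmod (a l) * cmod (b l))\<^sup>2" by (rule power_mono) simp
  also have "\<dots> \<le> (\<Sum>l<m. (cmod (a l))\<^sup>2) * (\<Sum>l<m. (cmod (b l))\<^sup>2)"
    by (rule Cauchy_Schwarz_ineq_sum)
  finally show ?thesis .
qed

lemma fsq_mult:
  assumes M: "M \<in> carrier_mat n m" and N: "N \<in> carrier_mat m k"
  shows "fsq (M * N) \<le> fsq M * fsq N"
proof -
  have "fsq (M * N) = (\<Sum>i<n. \<Sum>j<k. (cmod (\<Sum>l<m. M $$ (i, l) * N $$ (l, j)))\<^sup>2)"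
    using M N by (simp add: fsq_carrier[of _ n k] mult_index[OF M N] del: index_mult_mat(1))
  also have "\<dots> \<le> (\<Sum>i<n. \<Sum>j<k. (\<Sum>l<m. (cmod (M $$ (i, l)))\<^sup>2) * (\<Sum>l<m. (cmod (N $$ (l, j)))\<^sup>2))"
    by (intro sum_mono cauchy_schwarz_cmod)
  also have "\<dots> = fsq M * fsq N"
    by (simp add: fsq_carrier[OF M] fsq_carrier[OF N] sum_product sum.swap[of _ "{..<k}" "{..<m}"])
  finally show ?thesis .
qed

lemma cmod_mtrace_mult:
  assumes M: "M \<in> carrier_mat n n" and N: "N \<in> carrier_mat n n"
  shows "(cmod (mtrace (M * N)))\<^sup>2 \<le> fsq M * fsq N"
proof -
  let ?I = "{..<n} \<times> {..<n}"
  have "mtrace (M * N) = (\<Sum>(i, l)\<in>?I. M $$ (i, l) * N $$ (l, i))"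
    using M N by (simp add: mtrace_def mult_index[OF M N] sum.cartesian_product del: index_mult_mat(1))
  then have "cmod (mtrace (M * N)) \<le> (\<Sum>(i, l)\<in>?I. cmod (M $$ (i, l)) * cmod (N $$ (l, i)))"
    by (auto intro!: order_trans[OF norm_sum] sum_mono simp: norm_mult)
  then have "(cmod (mtrace (M * N)))\<^sup>2 \<le> (\<Sum>x\<in>?I. cmod (M $$ x) * cmod (N $$ (snd x, fst x)))\<^sup>2"
    by (intro power_mono) (auto simp: case_prod_beta)
  also have "\<dots> \<le> (\<Sum>x\<in>?I. (cmod (M $$ x))\<^sup>2) * (\<Sum>x\<in>?I. (cmod (N $$ (snd x, fst x)))\<^sup>2)"
    by (rule Cauchy_Schwarz_ineq_sum)
  also have "(\<Sum>x\<in>?I. (cmod (M $$ x))\<^sup>2) = fsq M"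
    by (simp add: fsq_carrier[OF M] sum.cartesian_product case_prod_beta)
  also have "(\<Sum>x\<in>?I. (cmod (N $$ (snd x, fst x)))\<^sup>2) = fsq N"
    by (subst fsq_carrier[OF N], subst sum.swap) (simp add: sum.cartesian_product case_prod_beta)
  finally show ?thesis .
qed

lemma fsq_unitary_left:
  assumes u: "u \<in> carrier (unitary_group n)" and M: "M \<in> carrier_mat n n"
  shows "fsq (u * M) = fsq M"
proof -
  note uc = unitaryD[OF u]
  have "complex_of_real (fsq (u * M)) = mtrace (mat_adjoint (u * M) * (u * M))"
    using uc M by (intro mtrace_adjoint_self[symmetric]) auto
  also have "mat_adjoint (u * M) * (u * M) = mat_adjoint M * M"
    using uc M mat_adjoint_carrier[OF M]
    by (simp add: mat_adjoint_mult[OF uc(1) M] assoc_mult_mat[of _ n n _ n _ n] square_mult_carrier[of _ n] unitary_cancel[where m = n, OF u])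
  finally show ?thesis using mtrace_adjoint_self[OF M] by simp
qed

lemma fsq_unitary_right:
  assumes u: "u \<in> carrier (unitary_group n)" and M: "M \<in> carrier_mat n n"
  shows "fsq (M * u) = fsq M"
  using fsq_unitary_left[OF mat_adjoint_in_unitary_group[OF u] mat_adjoint_carrier[OF M]]
  by (metis fsq_adjoint mat_adjoint_mult[OF M unitaryD(1)[OF u]])

text \<open>For a projection the trace equals the squared Frobenius norm, and submultiplicativity
  applied to \<open>q * q = q\<close> gives \<open>fsq q \<le> fsq q * fsq q\<close>. This takes the
  place of counting the rank.\<close>

lemma projection_trace:
  assumes q: "q \<in> carrier_mat n n" "mat_adjoint q = q" "q * q = q" "q \<noteq> 0\<^sub>m n n"
  shows "Re (mtrace q) \<ge> 1"
proof -
  have t: "mtrace q = of_real (fsq q)" using mtrace_adjoint_self[OF q(1)] q(2,3) by simp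
  have "fsq q > 0" using fsq_nonneg[of q] fsq_eq_0[OF q(1)] q(4) by (auto simp: order_less_le)
  moreover have "fsq q \<le> fsq q * fsq q" using fsq_mult[OF q(1) q(1)] q(3) by simp
  ultimately show ?thesis by (simp add: t)
qed

section \<open>Chains of commuting unitary matrices\<close>

text \<open>Chains grow at the head: each new matrix fails to commute with some \<open>x\<close>
  that commutes with the whole tail, so the commutants of the suffixes decrease strictly as the
  suffix grows.\<close>

primrec comm_chain :: "nat \<Rightarrow> complex mat list \<Rightarrow> bool" where
  "comm_chain n [] \<longleftrightarrow> True"
| "comm_chain n (u # us) \<longleftrightarrow> comm_chain n us \<and>
    (\<exists>x\<in>carrier_mat n n. u * x \<noteq> x * u \<and> (\<forall>v\<in>set us. v * x = x * v))"

lemma mat_adjoint_minus: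
  fixes M N :: "complex mat"
  assumes "M \<in> carrier_mat n m" "N \<in> carrier_mat n m"
  shows "mat_adjoint (M - N) = mat_adjoint M - mat_adjoint N"
  using assms mat_adjoint_carrier[OF assms(1)] mat_adjoint_carrier[OF assms(2)]
    mat_adjoint_carrier[OF minus_carrier_mat[OF assms(2), of M]]
  by (intro eq_matI) (auto simp: mat_adjoint_index)

lemma minus_eq_zero_mat:
  fixes M N :: "'a :: ring_1 mat"
  assumes "M \<in> carrier_mat n m" "N \<in> carrier_mat n m" "M - N = 0\<^sub>m n m"
  shows "M = N"
proof (rule eq_matI)
  fix i j assume "i < dim_row N" "j < dim_col N"
  then show "M $$ (i, j) = N $$ (i, j)"
    using assms(1,2) arg_cong[OF assms(3), of "\<lambda>M. M $$ (i, j)"] by (auto simp del: minus_carrier_mat)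
qed (use assms in auto)

lemma minus_self_mat: "(M :: 'a :: ring_1 mat) \<in> carrier_mat n m \<Longrightarrow> M - M = 0\<^sub>m n m"
  by (intro eq_matI) auto

context
  fixes n :: nat and u :: "complex mat" and us qs :: "complex mat list"
  assumes u: "u \<in> carrier (unitary_group n)"
    and qs: "\<And>q. q \<in> set qs \<Longrightarrow> q \<in> carrier_mat n n"
    and complete: "\<And>y. y \<in> carrier_mat n n \<Longrightarrow> (\<forall>q\<in>set qs. y * q = 0\<^sub>m n n) \<Longrightarrow> y = 0\<^sub>m n n"
begin

private lemmas ms = assoc_mult_mat[of _ n n _ n _ n] square_mult_carrier[of _ n]
    minus_mult_distrib_mat[of _ n n _ _ n] mult_minus_distrib_mat[of _ n n _ n]

text \<open>The assumption \<open>complete\<close> says that the ranges of the matrices in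
  \<open>qs\<close> together span the space. If every eigenprojection of \<open>u\<close> acted as 0
  or as the identity on each of these ranges, then \<open>x\<close>, which commutes with all of
  \<open>qs\<close>, would commute with every eigenprojection and therefore with
  \<open>u\<close>.\<close>

lemma ex_split_projection:
  assumes V: "V \<in> carrier (unitary_group n)" "u = V * mat_diag n d * mat_adjoint V"
    and x: "x \<in> carrier_mat n n" "u * x \<noteq> x * u" "\<And>q. q \<in> set qs \<Longrightarrow> q * x = x * q"
  shows "\<exists>q\<in>set qs. \<exists>c. eig_proj n V d c * q \<noteq> 0\<^sub>m n n \<and> eig_proj n V d c * q \<noteq> q"
proof (rule ccontr)
  assume nt: "\<not> (\<exists>q\<in>set qs. \<exists>c. eig_proj n V d c * q \<noteq> 0\<^sub>m n n \<and> eig_proj n V d c * q \<noteq> q)"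
  let ?P = "eig_proj n V d"
  have P: "?P c \<in> carrier_mat n n" for c by (rule fun_calc_carrier[OF V])
  have split: "?P c * q = 0\<^sub>m n n \<or> ?P c * q = q" if "q \<in> set qs" for c q
    using that nt by blast
  have comm: "x * ?P c = ?P c * x" for c
  proof (rule minus_eq_zero_mat)
    show "x * ?P c - ?P c * x = 0\<^sub>m n n"
    proof (rule complete)
      show "\<forall>q\<in>set qs. (x * ?P c - ?P c * x) * q = 0\<^sub>m n n"
      proof
        fix q assume q: "q \<in> set qs"
        have "(x * ?P c - ?P c * x) * q = x * (?P c * q) - ?P c * q * x"
          using P x q qs[OF q] by (simp add: ms)
        then show "(x * ?P c - ?P c * x) * q = 0\<^sub>m n n"
          using split[OF q, of c] x(1) x(3)[OF q] qs[OF q] by (auto simp: minus_self_mat[of _ n n] ms)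
      qed
    qed (use P x in \<open>auto intro!: minus_carrier_mat square_mult_carrier\<close>)
  qed (use P x in \<open>auto intro!: square_mult_carrier\<close>)
  have uc: "u \<in> carrier_mat n n" using unitaryD[OF u] by simp
  have "u * x - x * u = 0\<^sub>m n n"
  proof (rule eig_proj_complete[OF V])
    fix c
    have "(u * x - x * u) * ?P c = u * ?P c * x - x * (u * ?P c)"
      using P x uc by (simp add: ms comm)
    also have "\<dots> = 0\<^sub>m n n"
      unfolding eig_proj_eigen[OF V] using P[of c] x(1)
      by (simp add: comm mult_smult_assoc_mat[of _ n n] mult_smult_distrib[of _ n n] minus_self_mat[of _ n n] ms)
    finally show "(u * x - x * u) * ?P c = 0\<^sub>m n n" .
  qed (use x uc in \<open>auto intro!: minus_carrier_mat square_mult_carrier\<close>)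
  then show False using x(2) minus_eq_zero_mat[of "u * x" n n "x * u"] x(1) uc by (auto intro: square_mult_carrier)
qed

end

text \<open>Every element of the chain splits one projection into two nonzero ones. That each
  projection commutes with the whole commutant of \<open>us\<close> is carried along so that the
  next witness \<open>x\<close> commutes with all of them and \<open>ex_split_projection\<close>
  applies.\<close>

lemma comm_chain_projections:
  assumes "set us \<subseteq> carrier (unitary_group n)" "\<And>u v. u \<in> set us \<Longrightarrow> v \<in> set us \<Longrightarrow> u * v = v * u"
    "comm_chain n us" "n > 0"
  shows "\<exists>qs. length qs = Suc (length us) \<and>
    (\<forall>q\<in>set qs. q \<in> carrier_mat n n \<and> mat_adjoint q = q \<and> q * q = q \<and> q \<noteq> 0\<^sub>m n n \<and>
      (\<forall>x\<in>carrier_mat n n. (\<forall>v\<in>set us. v * x = x * v) \<longrightarrow> q * x = x * q)) \<and>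
    (\<forall>y\<in>carrier_mat n n. (\<forall>q\<in>set qs. y * q = 0\<^sub>m n n) \<longrightarrow> y = 0\<^sub>m n n) \<and>
    (\<Sum>q\<leftarrow>qs. mtrace q) = of_nat n"
  using assms
proof (induction us)
  case Nil
  have "(1\<^sub>m n :: complex mat) \<noteq> 0\<^sub>m n n" 
  proof
    assume "(1\<^sub>m n :: complex mat) = 0\<^sub>m n n"
    then have "(1\<^sub>m n :: complex mat) $$ (0, 0) = 0\<^sub>m n n $$ (0, 0)" by (rule arg_cong)
    then show False using Nil.prems(4) by simp
  qed
  then show ?case
    by (intro exI[of _ "[1\<^sub>m n]"]) (auto simp: mat_adjoint_one mtrace_def)
next
  case (Cons u us)
  have "set us \<subseteq> carrier (unitary_group n)" "\<And>u v. u \<in> set us \<Longrightarrow> v \<in> set us \<Longrightarrow> u * v = v * u" "comm_chain n us"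
    using Cons.prems by auto
  note IH = Cons.IH[OF this Cons.prems(4)]
  from IH obtain qs where len: "length qs = Suc (length us)"
    and q_all: "\<forall>q\<in>set qs. q \<in> carrier_mat n n \<and> mat_adjoint q = q \<and> q * q = q \<and> q \<noteq> 0\<^sub>m n n \<and>
      (\<forall>x\<in>carrier_mat n n. (\<forall>v\<in>set us. v * x = x * v) \<longrightarrow> q * x = x * q)"
    and compl_all: "\<forall>y\<in>carrier_mat n n. (\<forall>q\<in>set qs. y * q = 0\<^sub>m n n) \<longrightarrow> y = 0\<^sub>m n n"
    and tr: "(\<Sum>q\<leftarrow>qs. mtrace q) = of_nat n"
    by blast
  have qc: "\<And>q. q \<in> set qs \<Longrightarrow> q \<in> carrier_mat n n"
    and qp: "\<And>q. q \<in> set qs \<Longrightarrow> mat_adjoint q = q \<and> q * q = q \<and> q \<noteq> 0\<^sub>m n n"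
    and qx: "\<And>q x. q \<in> set qs \<Longrightarrow> x \<in> carrier_mat n n \<Longrightarrow> \<forall>v\<in>set us. v * x = x * v \<Longrightarrow> q * x = x * q"
    and compl: "\<And>y. y \<in> carrier_mat n n \<Longrightarrow> \<forall>q\<in>set qs. y * q = 0\<^sub>m n n \<Longrightarrow> y = 0\<^sub>m n n"
    using q_all compl_all by blast+
  have u: "u \<in> carrier (unitary_group n)" using Cons.prems by simp
  note uc = unitaryD(1)[OF u]
  obtain x where x: "x \<in> carrier_mat n n" "u * x \<noteq> x * u" "\<forall>v\<in>set us. v * x = x * v"
    using Cons.prems by auto
  obtain V d where V: "V \<in> carrier (unitary_group n)" "u = V * mat_diag n d * mat_adjoint V"
    using unitary_diagonalization[OF u] by blast
  obtain q c where q: "q \<in> set qs" "eig_proj n V d c * q \<noteq> 0\<^sub>m n n" "eig_proj n V d c * q \<noteq> q"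
    using ex_split_projection[OF u qc compl V x(1,2)] qx[OF _ x(1,3)] by blast
  let ?P = "eig_proj n V d c"
  note ms = assoc_mult_mat[of _ n n _ n _ n] square_mult_carrier[of _ n]
    minus_mult_distrib_mat[of _ n n _ _ n] mult_minus_distrib_mat[of _ n n _ n]
  have P: "?P \<in> carrier_mat n n" by (rule fun_calc_carrier[OF V])
  have PP: "?P * ?P = ?P" unfolding fun_calc_mult[OF V]
    by (rule arg_cong[where f = "fun_calc n V d"]) auto
  have Pa: "mat_adjoint ?P = ?P" unfolding fun_calc_adjoint[OF V]
    by (rule arg_cong[where f = "fun_calc n V d"]) auto
  have Px: "?P * x = x * ?P" if "x \<in> carrier_mat n n" "u * x = x * u" for x
    using fun_calc_commute[OF V that(1)] that(2) by metis
  note q1 = qc[OF q(1)] and q2 = qp[OF q(1)]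
  \<comment> \<open>\<open>u\<close> commutes with all of \<open>us\<close>, so it belongs to the
    commutant with which \<open>q\<close> commutes.\<close>
  have "u * q = q * u" using qx[OF q(1) uc] Cons.prems(2) by simp
  then have Pq: "?P * q = q * ?P" by (rule Px[OF q1])
  \<comment> \<open>\<open>q\<close> is replaced by its part \<open>r\<close> inside the eigenspace
    of \<open>c\<close> and its part \<open>s\<close> orthogonal to it. Both are nonzero by the
    choice of \<open>q\<close> and \<open>c\<close>.\<close>
  define r where "r = ?P * q"
  have r: "r \<in> carrier_mat n n" unfolding r_def using P q1 by (rule square_mult_carrier)
  have ra: "mat_adjoint r = r" unfolding r_def mat_adjoint_mult[OF P q1] using Pa q2 Pq by simp
  have qr: "q * r = r" unfolding r_def Pq using q1 q2 P by (simp add: assoc_mult_mat[of _ n n _ n _ n, symmetric])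
  have rq: "r * q = r" unfolding r_def using q1 q2 P by (simp add: ms)
  have Pr: "?P * r = r" unfolding r_def using q1 P by (simp add: PP assoc_mult_mat[of _ n n _ n _ n, symmetric])
  have rr: "r * r = r" using Pr qr q1 P r by (subst (1) r_def) (simp add: ms)
  define s where "s = q - r"
  have s: "s \<in> carrier_mat n n" unfolding s_def using r by (rule minus_carrier_mat)
  have sa: "mat_adjoint s = s" unfolding s_def mat_adjoint_minus[OF q1 r] using q2 ra by simp
  have ss: "s * s = s" unfolding s_def using q1 r q2 qr rq rr
    by (simp add: ms minus_carrier_mat) (intro eq_matI, auto)
  have r0: "r \<noteq> 0\<^sub>m n n" using q(2) by (simp add: r_def)
  have s0: "s \<noteq> 0\<^sub>m n n" using q(3) minus_eq_zero_mat[OF q1 r] by (auto simp: r_def s_def)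
  have rs: "r + s = q" unfolding s_def using q1 r by (intro eq_matI) auto
  have tr_q: "mtrace r + mtrace s = mtrace q" using mtrace_add[OF r s] rs by simp
  have rx: "r * x = x * r" if x: "x \<in> carrier_mat n n" "\<forall>v\<in>set (u # us). v * x = x * v" for x
  proof -
    have "r * x = ?P * (q * x)" unfolding r_def using P q1 x by (simp add: ms)
    also have "q * x = x * q" using x by (intro qx[OF q(1)]) auto
    also have "?P * (x * q) = ?P * x * q" using P q1 x by (simp add: ms)
    also have "?P * x = x * ?P" using x by (intro Px) auto
    finally show ?thesis unfolding r_def using P q1 x by (simp add: ms)
  qed
  have sx: "s * x = x * s" if x: "x \<in> carrier_mat n n" "\<forall>v\<in>set (u # us). v * x = x * v" for x
    unfolding s_def using q1 r rx[OF that] x qx[OF q(1), of x] by (simp add: ms)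
  obtain as bs where ab: "qs = as @ q # bs" using split_list[OF q(1)] by blast
  show ?case
  proof (intro exI[of _ "as @ r # s # bs"] conjI ballI impI)
    fix p assume p: "p \<in> set (as @ r # s # bs)"
    then have p': "p = r \<or> p = s \<or> p \<in> set qs" unfolding ab by auto
    then show "p \<in> carrier_mat n n" "mat_adjoint p = p" "p * p = p" "p \<noteq> 0\<^sub>m n n"
      using r s ra sa rr ss r0 s0 qc qp by auto
    fix x assume x: "x \<in> carrier_mat n n" "\<forall>v\<in>set (u # us). v * x = x * v"
    show "p * x = x * p" using p' rx[OF x] sx[OF x] qx[OF _ x(1)] x(2) by auto
  next
    fix y assume y: "y \<in> carrier_mat n n" "\<forall>p\<in>set (as @ r # s # bs). y * p = 0\<^sub>m n n"
    have "y * q = y * r + y * s" unfolding rs[symmetric] using y r s by (intro mult_add_distrib_mat) auto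
    then have "y * q = 0\<^sub>m n n" using y by simp
    then show "y = 0\<^sub>m n n" using y by (intro compl) (auto simp: ab)
  qed (use len tr in \<open>auto simp: ab algebra_simps tr_q[symmetric]\<close>)
qed

text \<open>A chain yields one projection more than its length, each of trace at least 1, and the
  traces add up to \<open>n\<close>.\<close>

lemma comm_chain_length:
  assumes "set us \<subseteq> carrier (unitary_group n)" "\<And>u v. u \<in> set us \<Longrightarrow> v \<in> set us \<Longrightarrow> u * v = v * u"
    "comm_chain n us" "n > 0"
  shows "length us < n"
proof -
  obtain qs where len: "length qs = Suc (length us)"
    and q: "\<forall>q\<in>set qs. q \<in> carrier_mat n n \<and> mat_adjoint q = q \<and> q * q = q \<and> q \<noteq> 0\<^sub>m n n"
    and tr: "(\<Sum>q\<leftarrow>qs. mtrace q) = of_nat n"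
    using comm_chain_projections[OF assms] by blast
  have "real (length qs) \<le> (\<Sum>q\<leftarrow>qs. Re (mtrace q))"
    using q by (induction qs) (auto dest!: projection_trace)
  also have "\<dots> = Re (\<Sum>q\<leftarrow>qs. mtrace q)" by (induction qs) auto
  finally show ?thesis using len tr by simp
qed

section \<open>Commutators and the Frobenius norm\<close>

text \<open>The commutant is taken in the full matrix algebra. Groups arise by intersecting it with
  the unitaries, and \<open>cent n (cent n X)\<close> is the double commutant.\<close>

definition cent :: "nat \<Rightarrow> complex mat set \<Rightarrow> complex mat set" where
  "cent n X = {x \<in> carrier_mat n n. \<forall>y\<in>X. x * y = y * x}"

lemma centD: "x \<in> cent n X \<Longrightarrow> x \<in> carrier_mat n n" "x \<in> cent n X \<Longrightarrow> y \<in> X \<Longrightarrow> x * y = y * x"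
  by (auto simp: cent_def)

lemma mult_unitary_group [simp]: "x \<otimes>\<^bsub>unitary_group n\<^esub> y = x * y"
  and one_unitary_group [simp]: "\<one>\<^bsub>unitary_group n\<^esub> = 1\<^sub>m n"
  by (simp_all add: unitary_group_def)

lemma one_in_unitary: "1\<^sub>m n \<in> carrier (unitary_group n)"
  by (simp add: unitary_group_def mat_adjoint_one)

lemma adjoint_commute:
  assumes u: "u \<in> carrier (unitary_group n)" and y: "y \<in> carrier_mat n n" and uy: "u * y = y * u"
  shows "mat_adjoint u * y = y * mat_adjoint u"
proof -
  note uc = unitaryD[OF u]
  note ms = assoc_mult_mat[of _ n n _ n _ n] square_mult_carrier[of _ n]
  have "mat_adjoint u * y = mat_adjoint u * (y * u) * mat_adjoint u" using uc y by (simp add: ms)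
  also have "mat_adjoint u * (y * u) = y" unfolding uy[symmetric] by (rule unitary_cancel(1)[OF u y])
  finally show ?thesis .
qed

lemma subgroup_unitary_cent:
  assumes X: "X \<subseteq> carrier_mat n n"
  shows "subgroup (carrier (unitary_group n) \<inter> cent n X) (unitary_group n)"
proof (rule group.subgroupI[OF group_unitary_group])
  show "carrier (unitary_group n) \<inter> cent n X \<noteq> {}"
  proof -
    have "1\<^sub>m n \<in> cent n X"
      using X by (auto simp: cent_def left_mult_one_mat[of _ n n] right_mult_one_mat[of _ n n] dest!: subsetD)
    then show ?thesis using one_in_unitary[of n] by blast
  qed
next
  fix a assume a: "a \<in> carrier (unitary_group n) \<inter> cent n X"
  then show "inv\<^bsub>unitary_group n\<^esub> a \<in> carrier (unitary_group n) \<inter> cent n X"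
    using X mat_adjoint_in_unitary_group[of a n] unitaryD(4)[of a n] adjoint_commute[of a n]
    by (auto simp: cent_def inv_unitary_group)
next
  fix a b assume a: "a \<in> carrier (unitary_group n) \<inter> cent n X" and b: "b \<in> carrier (unitary_group n) \<inter> cent n X"
  have c: "a \<in> carrier_mat n n" "b \<in> carrier_mat n n" using a b by (auto simp: cent_def)
  have "a * b * y = y * (a * b)" if y: "y \<in> X" for y
  proof -
    have yc: "y \<in> carrier_mat n n" using y X by auto
    have "a * b * y = a * (b * y)" using c yc by (rule assoc_mult_mat)
    also have "b * y = y * b" using b y by (auto simp: cent_def)
    also have "a * (y * b) = a * y * b" using c yc by (simp add: assoc_mult_mat[of _ n n _ n _ n])
    also have "a * y = y * a" using a y by (auto simp: cent_def)
    finally show ?thesis using c yc by (simp add: assoc_mult_mat[of _ n n _ n _ n])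
  qed
  then show "a \<otimes>\<^bsub>unitary_group n\<^esub> b \<in> carrier (unitary_group n) \<inter> cent n X"
    using unitary_mult[of a n b] a b c by (auto simp: cent_def square_mult_carrier)
qed auto

lemma fsq_minus_le:
  assumes "x \<in> carrier_mat n n" "y \<in> carrier_mat n n"
  shows "fsq (x - y) \<le> 2 * (fsq x + fsq y)"
proof -
  have "(cmod (a - b))\<^sup>2 \<le> 2 * ((cmod a)\<^sup>2 + (cmod b)\<^sup>2)" for a b :: complex
  proof -
    have "(cmod (a - b))\<^sup>2 \<le> (cmod a + cmod b)\<^sup>2" by (intro power_mono norm_triangle_ineq4) auto
    also have "\<dots> \<le> 2 * ((cmod a)\<^sup>2 + (cmod b)\<^sup>2)" 
      using zero_le_power2[of "cmod a - cmod b"] by (simp add: power2_eq_square algebra_simps)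
    finally show ?thesis .
  qed
  then have "fsq (x - y) \<le> (\<Sum>i<n. \<Sum>j<n. 2 * ((cmod (x $$ (i, j)))\<^sup>2 + (cmod (y $$ (i, j)))\<^sup>2))"
    using assms unfolding fsq_carrier[OF minus_carrier_mat[OF assms(2)]] by (intro sum_mono) auto
  also have "\<dots> = 2 * (fsq x + fsq y)"
    using assms by (simp add: fsq_carrier[of _ n n] sum.distrib sum_distrib_left[symmetric])
  finally show ?thesis .
qed

lemma fsq_unitary_diff:
  assumes x: "x \<in> carrier (unitary_group n)" and y: "y \<in> carrier (unitary_group n)"
  shows "fsq (mat_adjoint x * y - 1\<^sub>m n) = fsq (y - x)"
    and "fsq (y - x) \<le> 2 * (fsq (y - 1\<^sub>m n) + fsq (x - 1\<^sub>m n))"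
proof -
  note xc = unitaryD[OF x] and yc = unitaryD[OF y]
  have d: "y - x \<in> carrier_mat n n" using xc by auto
  have "mat_adjoint x * y - 1\<^sub>m n = mat_adjoint x * (y - x)"
    using xc yc by (simp add: mult_minus_distrib_mat[of _ n n _ n])
  then show "fsq (mat_adjoint x * y - 1\<^sub>m n) = fsq (y - x)"
    using fsq_unitary_left[OF mat_adjoint_in_unitary_group[OF x] d] by simp
  have "y - x = (y - 1\<^sub>m n) - (x - 1\<^sub>m n)" using xc yc by (intro eq_matI) auto
  then show "fsq (y - x) \<le> 2 * (fsq (y - 1\<^sub>m n) + fsq (x - 1\<^sub>m n))"
    using fsq_minus_le[of "y - 1\<^sub>m n" n "x - 1\<^sub>m n"] by (metis minus_carrier_mat one_carrier_mat)
qed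

text \<open>The commutator minus 1 is \<open>x * y - y * x\<close> times a unitary, and
  \<open>x * y - y * x\<close> is unchanged when 1 is subtracted from \<open>x\<close> and from
  \<open>y\<close>. The factor 4 is 2 for the squared triangle inequality times 2 for the two
  products.\<close>

lemma fsq_commutator:
  assumes x: "x \<in> carrier (unitary_group n)" and y: "y \<in> carrier (unitary_group n)"
  shows "fsq (x * y * mat_adjoint x * mat_adjoint y - 1\<^sub>m n) \<le> 4 * fsq (x - 1\<^sub>m n) * fsq (y - 1\<^sub>m n)"
proof -
  note xc = unitaryD[OF x] and yc = unitaryD[OF y]
  note ms = assoc_mult_mat[of _ n n _ n _ n] square_mult_carrier[of _ n]
    minus_mult_distrib_mat[of _ n n _ _ n] mult_minus_distrib_mat[of _ n n _ n]
    left_mult_one_mat[of _ n n] right_mult_one_mat[of _ n n]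
  let ?x = "x - 1\<^sub>m n" and ?y = "y - 1\<^sub>m n"
  have c: "?x \<in> carrier_mat n n" "?y \<in> carrier_mat n n" by auto
  have xy: "x * y - y * x = ?x * ?y - ?y * ?x"
  proof -
    have e: "(a - 1\<^sub>m n) * (b - 1\<^sub>m n) = a * b - a - (b - 1\<^sub>m n)"
      if a: "a \<in> carrier_mat n n" and b: "b \<in> carrier_mat n n" for a b :: "complex mat"
    proof -
      have "(a - 1\<^sub>m n) * (b - 1\<^sub>m n) = a * (b - 1\<^sub>m n) - 1\<^sub>m n * (b - 1\<^sub>m n)"
        by (rule minus_mult_distrib_mat[OF a one_carrier_mat]) auto
      moreover have "a * (b - 1\<^sub>m n) = a * b - a * 1\<^sub>m n"
        by (rule mult_minus_distrib_mat[OF a b one_carrier_mat])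
      moreover have "1\<^sub>m n * (b - 1\<^sub>m n) = b - 1\<^sub>m n" by (rule left_mult_one_mat) auto
      ultimately show ?thesis using a by (simp add: right_mult_one_mat[of _ n n])
    qed
    show ?thesis unfolding e[OF xc(1) yc(1)] e[OF yc(1) xc(1)]
      using xc yc by (intro eq_matI) (auto simp del: index_mult_mat(1))
  qed
  have d: "x * y - y * x \<in> carrier_mat n n" using xc yc by (auto intro!: minus_carrier_mat square_mult_carrier)
  have "x * y * mat_adjoint x * mat_adjoint y - 1\<^sub>m n = (x * y - y * x) * (mat_adjoint x * mat_adjoint y)"
    using xc yc by (simp add: ms unitary_cancel[where m = n, OF x])
  also have "fsq \<dots> = fsq (x * y - y * x)"
    by (rule fsq_unitary_right[OF unitary_mult d]) (intro mat_adjoint_in_unitary_group x y)+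
  also have "\<dots> \<le> 2 * (fsq (?x * ?y) + fsq (?y * ?x))"
    unfolding xy by (rule fsq_minus_le[OF square_mult_carrier[OF c] square_mult_carrier[OF c(2,1)]])
  also have "\<dots> \<le> 2 * (fsq ?x * fsq ?y + fsq ?y * fsq ?x)"
    by (intro mult_left_mono add_mono fsq_mult[OF c] fsq_mult[OF c(2,1)]) simp
  finally show ?thesis by (simp add: mult_ac)
qed

text \<open>Comparing the traces of $b \gamma b^* m^*$ and $\gamma z^* m^*$ for $m = 1 - z^*$ gives
  $\mathrm{tr}(\gamma m m^*) = 0$, which forces $m = 0$ when $\gamma$ is close to $1$.\<close>
lemma conj_eq_central_multiple:
  assumes g: "g \<in> carrier (unitary_group n)" and b: "b \<in> carrier (unitary_group n)"
    and z: "z \<in> carrier (unitary_group n)" and bz: "b * z = z * b"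
    and conj: "b * g * mat_adjoint b = g * mat_adjoint z" and small: "fsq (g - 1\<^sub>m n) < 1"
  shows "z = 1\<^sub>m n"
proof -
  note gc = unitaryD[OF g] and bc = unitaryD[OF b] and zc = unitaryD[OF z]
  note ms = assoc_mult_mat[of _ n n _ n _ n] square_mult_carrier[of _ n]
    minus_mult_distrib_mat[of _ n n _ _ n] mult_minus_distrib_mat[of _ n n _ n]
    left_mult_one_mat[of _ n n] right_mult_one_mat[of _ n n]
  define m where "m = 1\<^sub>m n - mat_adjoint z"
  have m: "m \<in> carrier_mat n n" unfolding m_def using zc by auto
  have ma: "mat_adjoint m = 1\<^sub>m n - z"
    unfolding m_def using zc mat_adjoint_carrier[OF minus_carrier_mat[OF zc(4), of "1\<^sub>m n"]]
    by (intro eq_matI) (auto simp: mat_adjoint_index)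
  have mac: "mat_adjoint m \<in> carrier_mat n n" using m by (rule mat_adjoint_carrier)
  have bm: "mat_adjoint b * mat_adjoint m = mat_adjoint m * mat_adjoint b"
  proof (rule adjoint_commute[OF b mac])
    show "b * mat_adjoint m = mat_adjoint m * b" unfolding ma using bc zc bz by (simp add: ms)
  qed
  have "mtrace (g * mat_adjoint z * mat_adjoint m) = mtrace (b * (g * mat_adjoint m * mat_adjoint b))"
    unfolding conj[symmetric] using bc gc mac by (simp add: ms bm)
  also have "\<dots> = mtrace (g * mat_adjoint m)"
    using bc gc mac by (subst mtrace_comm[of _ n n]) (auto simp: ms)
  finally have "mtrace (g * m * mat_adjoint m) = 0"
    using gc zc mac m unfolding m_def[THEN arg_cong[of _ _ "\<lambda>m. g * m"]]
    by (simp add: ms mtrace_minus[of _ n])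
  \<comment> \<open>Writing \<open>g\<close> as 1 plus \<open>g - 1m\<close> turns the vanishing
    trace into an identity between \<open>fsq m\<close> and a trace involving \<open>g - 1\<close>;
    Cauchy-Schwarz then bounds \<open>(fsq m)^2\<close> by \<open>fsq (g - 1)\<close> times
    itself.\<close>
  moreover have "g * m * mat_adjoint m = m * mat_adjoint m + (g - 1\<^sub>m n) * (m * mat_adjoint m)"
    using gc mac m by (simp add: ms) (intro eq_matI, auto)
  moreover have "mtrace (m * mat_adjoint m) = of_real (fsq m)"
    using mtrace_comm[OF m mac] mtrace_adjoint_self[OF m] by simp
  moreover have mm: "m * mat_adjoint m \<in> carrier_mat n n" "g - 1\<^sub>m n \<in> carrier_mat n n"
    using m mac by (auto intro!: square_mult_carrier)
  ultimately have "mtrace ((g - 1\<^sub>m n) * (m * mat_adjoint m)) = - of_real (fsq m)"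
    using mtrace_add[OF mm(1) square_mult_carrier[OF mm(2,1)]] by (simp add: add_eq_0_iff)
  then have "(fsq m)\<^sup>2 \<le> fsq (g - 1\<^sub>m n) * fsq (m * mat_adjoint m)"
    using cmod_mtrace_mult[OF mm(2,1)] by simp
  also have "\<dots> \<le> fsq (g - 1\<^sub>m n) * (fsq m * fsq m)"
    using fsq_mult[OF m mac] by (intro mult_left_mono fsq_nonneg) (simp add: fsq_adjoint)
  finally have "(1 - fsq (g - 1\<^sub>m n)) * (fsq m)\<^sup>2 \<le> 0" by (simp add: power2_eq_square algebra_simps)
  then have "fsq m = 0" using small by (simp add: mult_le_0_iff)
  then have "fsq (mat_adjoint m) = 0" by (simp add: fsq_adjoint)
  from fsq_eq_0[OF mac this] have "1\<^sub>m n - z = 0\<^sub>m n n" by (simp only: ma)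
  then show ?thesis using minus_eq_zero_mat[OF one_carrier_mat zc(1)] by simp
qed

section \<open>Pigeonholing unitary matrices into small cells\<close>

lemma unitary_entry_le_1:
  assumes u: "u \<in> carrier (unitary_group n)" and ij: "i < n" "j < n"
  shows "cmod (u $$ (i, j)) \<le> 1"
proof -
  note uc = unitaryD[OF u]
  have "(\<Sum>l<n. cnj (u $$ (l, j)) * u $$ (l, j)) = 1"
    using adjoint_mult_index[OF uc(1) uc(1) ij(2) ij(2)] uc(2) ij by simp
  then have "complex_of_real (\<Sum>l<n. (cmod (u $$ (l, j)))\<^sup>2) = 1"
    by (simp add: mult.commute flip: complex_norm_square)
  then have s: "(\<Sum>l<n. (cmod (u $$ (l, j)))\<^sup>2) = 1" by (simp only: of_real_eq_1_iff)
  have "(cmod (u $$ (i, j)))\<^sup>2 \<le> 1"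
    unfolding s[symmetric] using ij by (intro member_le_sum[where f = "\<lambda>l. (cmod (u $$ (l, j)))\<^sup>2"]) auto
  then show ?thesis by (simp add: abs_square_le_1)
qed

text \<open>Round the real and imaginary parts of all entries to a grid of side 1/(8n) and let
  \<open>E\<close> be the fullest cell. Along each of the 2n^2 real coordinates the rounded value
  takes at most 16n + 1 values.\<close>

lemma unitary_pigeonhole:
  assumes B: "finite B" "B \<subseteq> carrier (unitary_group n)" and n: "n > 0"
  obtains E where "E \<subseteq> B" "card B \<le> (16 * n + 1) ^ (2 * n\<^sup>2) * card E"
    "\<And>e e'. e \<in> E \<Longrightarrow> e' \<in> E \<Longrightarrow> fsq (e' - e) \<le> 1 / 25"
proof -
  define L :: int where "L = 8 * int n"
  have L0: "L > 0" using n by (simp add: L_def)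
  define I where "I = {..<n} \<times> {..<n}"
  define cell where "cell u = (\<lambda>ij\<in>I. (\<lfloor>of_int L * Re (u $$ ij)\<rfloor>, \<lfloor>of_int L * Im (u $$ ij)\<rfloor>))" for u :: "complex mat"
  define R where "R = (I \<rightarrow>\<^sub>E {-L..L} \<times> {-L..L})"
  have finR: "finite R" by (auto simp: R_def I_def intro!: finite_PiE)
  have "card R = (card ({-L..L} \<times> {-L..L})) ^ card I"
    unfolding R_def by (subst card_PiE) (auto simp: I_def)
  also have "card ({-L..L} \<times> {-L..L}) = (16 * n + 1)\<^sup>2"
    by (simp add: card_cartesian_product L_def power2_eq_square nat_add_distrib nat_mult_distrib algebra_simps)
  also have "card I = n\<^sup>2" by (simp add: I_def power2_eq_square)
  finally have cardR: "card R = (16 * n + 1) ^ (2 * n\<^sup>2)" by (simp add: power_mult)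
  have cellR: "cell ` B \<subseteq> R"
  proof (rule image_subsetI)
    fix u assume "u \<in> B"
    then have u: "u \<in> carrier (unitary_group n)" using B by auto
    have fl: "\<lfloor>of_int L * t\<rfloor> \<in> {-L..L}" if "\<bar>t\<bar> \<le> 1" for t :: real
    proof -
      have "of_int L * t \<le> of_int L * 1" "of_int L * (-1) \<le> of_int L * t"
        using that L0 by (intro mult_left_mono; simp)+
      then show ?thesis by (auto simp: floor_le_iff le_floor_iff)
    qed
    have "\<bar>Re (u $$ ij)\<bar> \<le> 1 \<and> \<bar>Im (u $$ ij)\<bar> \<le> 1" if "ij \<in> I" for ij
      using unitary_entry_le_1[OF u] that abs_Re_le_cmod[of "u $$ ij"] abs_Im_le_cmod[of "u $$ ij"]
      by (fastforce simp: I_def)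
    then show "cell u \<in> R" using fl unfolding R_def cell_def by auto
  qed
  have close: "fsq (u - v) \<le> 1 / 25" if u: "u \<in> B" and v: "v \<in> B" and uv: "cell u = cell v" for u v
  proof -
    have c: "u \<in> carrier_mat n n" "v \<in> carrier_mat n n" using u v B unitaryD(1) by blast+
    have fl: "(s - t)\<^sup>2 \<le> 1 / (8 * real n)\<^sup>2" if "\<lfloor>of_int L * s\<rfloor> = \<lfloor>of_int L * t\<rfloor>" for s t :: real
    proof -
      have "\<bar>of_int L * s - of_int L * t\<bar> < 1" using that by linarith
      then have "(of_int L * s - of_int L * t)\<^sup>2 \<le> 1" by (simp add: abs_square_le_1)
      also have "(of_int L * s - of_int L * t)\<^sup>2 = (8 * real n)\<^sup>2 * (s - t)\<^sup>2"
        by (simp add: L_def power2_eq_square algebra_simps)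
      finally show ?thesis using n by (simp add: field_simps)
    qed
    have "(cmod ((u - v) $$ (i, j)))\<^sup>2 \<le> 2 / (8 * real n)\<^sup>2" if "i < n" "j < n" for i j
    proof -
      have "(i, j) \<in> I" using that by (simp add: I_def)
      then have "\<lfloor>of_int L * Re (u $$ (i, j))\<rfloor> = \<lfloor>of_int L * Re (v $$ (i, j))\<rfloor>"
        "\<lfloor>of_int L * Im (u $$ (i, j))\<rfloor> = \<lfloor>of_int L * Im (v $$ (i, j))\<rfloor>"
        using fun_cong[OF uv, of "(i, j)"] by (auto simp: cell_def)
      from fl[OF this(1)] fl[OF this(2)] show ?thesis
        using that c by (simp add: cmod_power2)
    qed
    then have "fsq (u - v) \<le> (\<Sum>i<n. \<Sum>j<n. 2 / (8 * real n)\<^sup>2)"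
      unfolding fsq_carrier[OF minus_carrier_mat[OF c(2)]] by (intro sum_mono) auto
    \<comment> \<open>The sum equals 2/64. The bound 1/25 is small enough for the commutator
      estimates: even 4 * 4/25 stays below 1.\<close>
    also have "\<dots> \<le> 1 / 25" using n by (simp add: power2_eq_square)
    finally show ?thesis .
  qed
  have Rne: "R \<noteq> {}" using L0 by (auto simp: R_def PiE_eq_empty_iff)
  define k where "k = Max ((\<lambda>y. card {u\<in>B. cell u = y}) ` R)"
  have "k \<in> (\<lambda>y. card {u\<in>B. cell u = y}) ` R"
    unfolding k_def using finR Rne by (intro Max_in) auto
  then obtain y where y: "k = card {u\<in>B. cell u = y}" by auto
  have "card B \<le> k * card R"
    by (rule card_le_fibres[OF B(1) finR cellR]) (auto simp: k_def finR)
  then show thesis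
  proof (intro that[of "{u\<in>B. cell u = y}"])
    show "fsq (e' - e) \<le> 1 / 25" if "e \<in> {u\<in>B. cell u = y}" "e' \<in> {u\<in>B. cell u = y}" for e e'
      using that by (intro close) auto
  qed (auto simp: y cardR mult.commute)
qed


text \<open>Cancelling \<open>x\<close> in \<open>[x, e] q = [x, e']\<close> and conjugating by the
  inverse of \<open>e\<close> shows that the quotient of \<open>e\<close> and \<open>e'\<close>
  conjugates the inverse of \<open>x\<close> to that inverse times \<open>q\<close>; here
  \<open>q\<close> moves past \<open>e\<close>. Taking adjoints gives the claim, since
  \<open>q\<close> also commutes with \<open>x\<close>.\<close>

lemma commutator_quotient:
  assumes x: "x \<in> carrier (unitary_group n)" and e: "e \<in> carrier (unitary_group n)" and e': "e' \<in> carrier (unitary_group n)"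
    and q: "q = mat_adjoint (x * e * mat_adjoint x * mat_adjoint e) * (x * e' * mat_adjoint x * mat_adjoint e')"
    and qx: "q * x = x * q" and qe: "q * e = e * q"
  shows "mat_adjoint e * e' * x * mat_adjoint (mat_adjoint e * e') = x * mat_adjoint q"
proof -
  note xc = unitaryD[OF x] and ec = unitaryD[OF e] and ec' = unitaryD[OF e']
  note ms = assoc_mult_mat[of _ n n _ n _ n] square_mult_carrier[of _ n]
    unitary_cancel[where m = n, OF x] unitary_cancel[where m = n, OF e] unitary_cancel[where m = n, OF e']
  let ?c = "\<lambda>e. x * e * mat_adjoint x * mat_adjoint e" and ?b = "mat_adjoint e * e'"
  have c: "?c e \<in> carrier (unitary_group n)" "?c e' \<in> carrier (unitary_group n)"
    using x e e' by (auto intro!: unitary_mult mat_adjoint_in_unitary_group)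
  have qU: "q \<in> carrier (unitary_group n)"
    unfolding q by (rule unitary_mult[OF mat_adjoint_in_unitary_group[OF c(1)] c(2)])
  note qc = unitaryD[OF qU]
  have b: "?b \<in> carrier (unitary_group n)"
    using e e' by (intro unitary_mult mat_adjoint_in_unitary_group)
  note bc = unitaryD[OF b]
  have ba: "mat_adjoint ?b = mat_adjoint e' * e"
    using ec ec' by (simp add: mat_adjoint_mult[of _ n n _ n] mat_adjoint_adjoint[of _ n n])
  have "?c e * q = ?c e'"
    unfolding q by (rule unitary_cancel(2)[OF c(1) unitaryD(1)[OF c(2)]])
  then have "mat_adjoint x * (?c e * q) = mat_adjoint x * ?c e'" by simp
  then have s1: "e * (mat_adjoint x * (mat_adjoint e * q)) = e' * (mat_adjoint x * mat_adjoint e')"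
    using xc ec ec' qc by (simp add: ms)
  have "?b * mat_adjoint x * mat_adjoint ?b = mat_adjoint e * (e' * (mat_adjoint x * mat_adjoint e')) * e"
    unfolding ba using xc ec ec' by (simp add: ms)
  also have "\<dots> = mat_adjoint x * (mat_adjoint e * (q * e))"
    unfolding s1[symmetric] using xc ec qc by (simp add: ms)
  also have "\<dots> = mat_adjoint x * q" unfolding qe using ec qc by (simp add: ms)
  finally have "mat_adjoint (?b * mat_adjoint x * mat_adjoint ?b) = mat_adjoint (mat_adjoint x * q)" by simp
  then have "?b * (x * mat_adjoint ?b) = mat_adjoint q * x"
    using xc bc qc
    by (simp add: mat_adjoint_mult[of _ n n _ n] mat_adjoint_adjoint[of _ n n] square_mult_carrier[of _ n] del: mat_adjoint_mult)
  then show ?thesis using adjoint_commute[OF qU xc(1) qx] assoc_mult_mat[OF bc(1) xc(1) bc(4)] by simp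
qed

section \<open>A normalised torus containing many short words\<close>

lemma fsq_quotient:
  assumes x: "x \<in> carrier (unitary_group n)" "fsq (x - 1\<^sub>m n) \<le> a"
    and y: "y \<in> carrier (unitary_group n)" "fsq (y - 1\<^sub>m n) \<le> a"
  shows "fsq (mat_adjoint x * y - 1\<^sub>m n) \<le> 4 * a"
proof -
  have "fsq (mat_adjoint x * y - 1\<^sub>m n) \<le> 2 * (fsq (y - 1\<^sub>m n) + fsq (x - 1\<^sub>m n))"
    unfolding fsq_unitary_diff(1)[OF x(1) y(1)] by (rule fsq_unitary_diff(2)[OF x(1) y(1)])
  also have "\<dots> \<le> 2 * (a + a)"
    by (intro mult_left_mono add_mono x(2) y(2)) simp
  finally show ?thesis by simp
qed

locale unitary_tripling = small_tripling "unitary_group n" A K for n :: nat and A :: "complex mat set" and K :: real +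
  assumes n_pos: "n > 0"
begin

abbreviation U :: "complex mat set" where "U \<equiv> carrier (unitary_group n)"

lemma W_U: "x \<in> W m \<Longrightarrow> x \<in> U"
  by (rule W_in_carrier)

lemma W_mult_mat: "x \<in> W k \<Longrightarrow> y \<in> W m \<Longrightarrow> x * y \<in> W (k + m)"
  using W_mult[of x k y m] by simp

lemma W_adjoint: "x \<in> W m \<Longrightarrow> mat_adjoint x \<in> W m"
  using W_inv[of x m] W_U[of x m] by (simp add: inv_unitary_group)

text \<open>For a set \<open>G\<close> of commuting unitaries, \<open>Z G\<close> is the group H of
  the overview and \<open>Z (cent n G)\<close> is its centre.\<close>

abbreviation Z :: "complex mat set \<Rightarrow> complex mat set" where "Z X \<equiv> U \<inter> cent n X"

lemma Z_mult: "X \<subseteq> carrier_mat n n \<Longrightarrow> x \<in> Z X \<Longrightarrow> y \<in> Z X \<Longrightarrow> x * y \<in> Z X"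
  using subgroup.m_closed[OF subgroup_unitary_cent, of X n x y] by simp

lemma Z_adjoint: "X \<subseteq> carrier_mat n n \<Longrightarrow> x \<in> Z X \<Longrightarrow> mat_adjoint x \<in> Z X"
  using subgroup.m_inv_closed[OF subgroup_unitary_cent, of X n x] by (auto simp: inv_unitary_group)

lemma cent_carrier: "cent n X \<subseteq> carrier_mat n n"
  by (auto simp: cent_def)

text \<open>The number of cells available in \<open>unitary_pigeonhole\<close>.\<close>

definition cover :: real where "cover = real ((16 * n + 1) ^ (2 * n\<^sup>2))"

lemma cover_ge_1: "cover \<ge> 1"
  unfolding cover_def by (subst real_of_nat_ge_one_iff) simp

text \<open>The fullest cell is translated by the inverse of one of its members, which moves it
  close to 1 and doubles the word length.\<close>

lemma near_identity:
  assumes X: "X \<subseteq> carrier_mat n n"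
  obtains E where "E \<subseteq> W 4 \<inter> Z X" "real (card (W 2 \<inter> Z X)) \<le> cover * real (card E)"
    "\<And>e. e \<in> E \<Longrightarrow> fsq (e - 1\<^sub>m n) \<le> 1 / 25"
proof -
  have fin: "finite (W 2 \<inter> Z X)" using finite_W by auto
  obtain E0 where E0: "E0 \<subseteq> W 2 \<inter> Z X" "card (W 2 \<inter> Z X) \<le> (16 * n + 1) ^ (2 * n\<^sup>2) * card E0"
    "\<And>e e'. e \<in> E0 \<Longrightarrow> e' \<in> E0 \<Longrightarrow> fsq (e' - e) \<le> 1 / 25"
    by (rule unitary_pigeonhole[OF fin _ n_pos]) auto
  have le: "real (card (W 2 \<inter> Z X)) \<le> cover * real (card E0)"
    unfolding cover_def of_nat_mult[symmetric] of_nat_le_iff by (rule E0(2))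
  show thesis
  proof (cases "E0 = {}")
    case True
    then show thesis using le by (intro that[of "{}"]) auto
  next
    case False
    then obtain e0 where e0: "e0 \<in> E0" by auto
    have e0': "e0 \<in> W 2" "e0 \<in> Z X" "e0 \<in> U" using e0 E0(1) by auto
    have inj: "inj_on ((*) (mat_adjoint e0)) E0"
    proof (rule inj_onI)
      fix x y assume xy: "x \<in> E0" "y \<in> E0" "mat_adjoint e0 * x = mat_adjoint e0 * y"
      then have c: "x \<in> carrier_mat n n" "y \<in> carrier_mat n n" using E0(1) unitaryD(1) by blast+
      show "x = y" using unitary_cancel(2)[OF e0'(3) c(1)] unitary_cancel(2)[OF e0'(3) c(2)] xy(3) by metis
    qed
    show thesis
    proof (rule that[of "(*) (mat_adjoint e0) ` E0"])
      show "(*) (mat_adjoint e0) ` E0 \<subseteq> W 4 \<inter> Z X"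
      proof (rule image_subsetI)
        fix x assume "x \<in> E0"
        then have x: "x \<in> W 2" "x \<in> Z X" using E0(1) by auto
        then show "mat_adjoint e0 * x \<in> W 4 \<inter> Z X"
          using W_mult_mat[OF W_adjoint[OF e0'(1)] x(1)] Z_mult[OF X Z_adjoint[OF X e0'(2)] x(2)] by simp
      qed
      show "real (card (W 2 \<inter> Z X)) \<le> cover * real (card ((*) (mat_adjoint e0) ` E0))"
        using le by (simp add: card_image[OF inj])
      fix e assume "e \<in> (*) (mat_adjoint e0) ` E0"
      then obtain x where x: "x \<in> E0" "e = mat_adjoint e0 * x" by auto
      then show "fsq (e - 1\<^sub>m n) \<le> 1 / 25"
        using fsq_unitary_diff(1)[OF e0'(3), of x] E0(1,3) e0 by fastforce
    qed
  qed
qed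

text \<open>One round of the Jordan argument. If every short word close to 1 lies in the double
  commutant, then so do the quotients of \<open>E\<close> in \<open>W 2\<close>, and packing gives
  the first alternative. Otherwise let \<open>g\<close> be an exceptional word closest to 1: it has
  few commutators with \<open>E\<close>, and each fibre of the commutator map translates into the
  centraliser of \<open>g\<close>.\<close>

lemma ex_large_centralizer:
  assumes G: "G \<subseteq> U"
  shows "real (card (W 2 \<inter> Z G)) \<le> cover * K ^ 20 * real (card (W 2 \<inter> Z (cent n G))) \<or>
    (\<exists>g\<in>W 2 \<inter> Z G. g \<notin> cent n (cent n G) \<and>
      real (card (W 2 \<inter> Z G)) \<le> cover * K ^ 20 * real (card (W 2 \<inter> Z (insert g G))))"
proof -
  have Gc: "G \<subseteq> carrier_mat n n" using G unitaryD(1) by blast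
  obtain E where E: "E \<subseteq> W 4 \<inter> Z G" "real (card (W 2 \<inter> Z G)) \<le> cover * real (card E)"
    "\<And>e. e \<in> E \<Longrightarrow> fsq (e - 1\<^sub>m n) \<le> 1 / 25"
    using near_identity[OF Gc] by blast
  have EU: "e \<in> U" "e \<in> W 4" "e \<in> Z G" if "e \<in> E" for e using that E(1) by auto
  have finE: "finite E" using E(1) finite_W finite_subset by blast
  \<comment> \<open>The bound 4/25 is what \<open>fsq_quotient\<close> yields for quotients of
    elements of \<open>E\<close>.\<close>
  define B where "B = {g \<in> W 2 \<inter> Z G. fsq (g - 1\<^sub>m n) \<le> 4 / 25 \<and> g \<notin> cent n (cent n G)}"
  have finB: "finite B" unfolding B_def using finite_W by auto
  have K0: "K \<ge> 0" using K_ge_1 by simp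
  show ?thesis
  proof (cases "B = {}")
    case True
    have "real (card E) \<le> K ^ 4 * real (card (W 2 \<inter> Z (cent n G)))"
    proof (rule packing)
      fix p p' assume p: "p \<in> E" "p' \<in> E" and "inv\<^bsub>unitary_group n\<^esub> p \<otimes>\<^bsub>unitary_group n\<^esub> p' \<in> W 2"
      then have w: "mat_adjoint p * p' \<in> W 2" using EU(1) by (simp add: inv_unitary_group)
      have z: "mat_adjoint p * p' \<in> Z G"
        using EU(3) p by (intro Z_mult Z_adjoint Gc)
      have "fsq (mat_adjoint p * p' - 1\<^sub>m n) \<le> 4 * (1 / 25)"
        by (rule fsq_quotient) (intro EU(1) E(3) p)+
      then have "mat_adjoint p * p' \<in> cent n (cent n G)" using True w z unfolding B_def by auto
      then show "inv\<^bsub>unitary_group n\<^esub> p \<otimes>\<^bsub>unitary_group n\<^esub> p' \<in> W 2 \<inter> Z (cent n G)"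
        using w z p EU(1) by (simp add: inv_unitary_group)
    qed (use E(1) finite_W in auto)
    then have "real (card (W 2 \<inter> Z G)) \<le> cover * (K ^ 4 * real (card (W 2 \<inter> Z (cent n G))))"
      using E(2) cover_ge_1 by (meson mult_left_mono order_trans zero_le_one)
    \<comment> \<open>The exponent is raised from 4 to 20 so that both alternatives have the same
      cost.\<close>
    also have "\<dots> \<le> cover * (K ^ 20 * real (card (W 2 \<inter> Z (cent n G))))"
      using cover_ge_1 K_ge_1 by (intro mult_left_mono mult_right_mono power_increasing) auto
    finally show ?thesis by (simp add: mult.assoc)
  next
    case False
    define g where "g = arg_min_on (\<lambda>g. fsq (g - 1\<^sub>m n)) B"
    have gB: "g \<in> B" unfolding g_def by (rule arg_min_if_finite(1)[OF finB False])
    have gmin: "\<And>h. h \<in> B \<Longrightarrow> fsq (g - 1\<^sub>m n) \<le> fsq (h - 1\<^sub>m n)"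
      unfolding g_def by (rule arg_min_least[OF finB False])
    have g: "g \<in> W 2" "g \<in> Z G" "g \<in> U" "fsq (g - 1\<^sub>m n) \<le> 4 / 25" "g \<notin> cent n (cent n G)"
      using gB by (auto simp: B_def)
    have one_cent: "1\<^sub>m n \<in> cent n (cent n G)"
      by (auto simp: cent_def)
    have gpos: "fsq (g - 1\<^sub>m n) > 0"
    proof -
      have "g - 1\<^sub>m n \<noteq> 0\<^sub>m n n"
        using minus_eq_zero_mat[OF unitaryD(1)[OF g(3)] one_carrier_mat] one_cent g(5) by auto
      then have "fsq (g - 1\<^sub>m n) \<noteq> 0" using fsq_eq_0[OF minus_carrier_mat[OF one_carrier_mat]] by blast
      then show ?thesis using fsq_nonneg[of "g - 1\<^sub>m n"] by linarith
    qed
    define c where "c e = g * e * mat_adjoint g * mat_adjoint e" for e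
    have cU: "c e \<in> U" and cZ: "c e \<in> Z G" and cW: "c e \<in> W 12" if e: "e \<in> E" for e
    proof -
      show "c e \<in> Z G" unfolding c_def by (intro Z_mult Z_adjoint Gc g(2) EU(3) e)
      then show "c e \<in> U" by simp
      have "g * e * mat_adjoint g * mat_adjoint e \<in> W (2 + 4 + 2 + 4)"
        by (intro W_mult_mat W_adjoint g(1) EU(2) e)
      then show "c e \<in> W 12" by (simp add: c_def)
    qed
    have small: "fsq (c e - 1\<^sub>m n) \<le> 4 / 25 * fsq (g - 1\<^sub>m n)" if "e \<in> E" for e
    proof -
      have "fsq (c e - 1\<^sub>m n) \<le> 4 * fsq (g - 1\<^sub>m n) * fsq (e - 1\<^sub>m n)"
        unfolding c_def by (rule fsq_commutator[OF g(3) EU(1)[OF that]])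
      also have "\<dots> \<le> 4 * fsq (g - 1\<^sub>m n) * (1 / 25)"
        using E(3)[OF that] by (intro mult_left_mono) (auto simp: fsq_nonneg)
      finally show ?thesis by simp
    qed
    \<comment> \<open>Packing with a trivial \<open>Q\<close>: two commutators must coincide as soon
      as their quotient lies in \<open>W 2\<close>. A commutator of words of lengths 2 and 4 has
      length 12.\<close>
    have "real (card (c ` E)) \<le> K ^ 12 * real (card {1\<^sub>m n :: complex mat})"
    proof (rule packing)
      fix p p' assume p: "p \<in> c ` E" "p' \<in> c ` E" and w: "inv\<^bsub>unitary_group n\<^esub> p \<otimes>\<^bsub>unitary_group n\<^esub> p' \<in> W 2"
      obtain e e' where e: "e \<in> E" "e' \<in> E" and pe: "p = c e" "p' = c e'" using p by auto
      define q where "q = mat_adjoint (c e) * c e'"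
      have inv_p: "inv\<^bsub>unitary_group n\<^esub> p \<otimes>\<^bsub>unitary_group n\<^esub> p' = q"
        using cU[OF e(1)] by (simp add: pe inv_unitary_group q_def)
      have qW: "q \<in> W 2" using w by (simp only: inv_p)
      have qZ: "q \<in> Z G" unfolding q_def by (intro Z_mult Z_adjoint Gc cZ e)
      \<comment> \<open>The factor 16/25 makes \<open>q\<close> strictly closer to 1 than
        \<open>g\<close>, so minimality puts \<open>q\<close> in the double commutant. It then
        commutes with \<open>g\<close>, \<open>e\<close> and \<open>e'\<close>, as the next two
        lemmas to be applied require.\<close>
      have "fsq (q - 1\<^sub>m n) \<le> 4 * (4 / 25 * fsq (g - 1\<^sub>m n))"
        unfolding q_def by (rule fsq_quotient) (intro cU small e)+
      also have "\<dots> < fsq (g - 1\<^sub>m n)" using gpos by simp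
      finally have q_lt: "fsq (q - 1\<^sub>m n) < fsq (g - 1\<^sub>m n)" .
      then have "q \<notin> B" using gmin[of q] leD by blast
      then have qc: "q \<in> cent n (cent n G)" using qW qZ q_lt g(4) unfolding B_def by auto
      have comm: "q * x = x * q" if "x \<in> Z G" for x using centD(2)[OF qc, of x] that by simp
      let ?b = "mat_adjoint e * e'"
      have b: "?b \<in> Z G" by (intro Z_mult Z_adjoint Gc EU(3) e)
      have "?b * g * mat_adjoint ?b = g * mat_adjoint q"
        by (rule commutator_quotient[OF g(3) EU(1)[OF e(1)] EU(1)[OF e(2)]])
          (auto simp: q_def[unfolded c_def] intro!: comm g(2) EU(3) e simp flip: q_def[unfolded c_def])
      then have "q = 1\<^sub>m n"
        using b qZ comm[OF b] g(3,4) by (intro conj_eq_central_multiple[of g n ?b q]) auto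
      then show "inv\<^bsub>unitary_group n\<^esub> p \<otimes>\<^bsub>unitary_group n\<^esub> p' \<in> {1\<^sub>m n}" by (simp only: inv_p) simp
    qed (use cW in auto)
    then have cardc: "real (card (c ` E)) \<le> K ^ 12" by simp
    have Gi: "insert g G \<subseteq> carrier_mat n n" using Gc unitaryD(1)[OF g(3)] by simp
    have "card E \<le> card (W 8 \<inter> Z (insert g G)) * card (c ` E)"
    proof (rule card_le_fibres[where f = c])
      fix y assume "y \<in> c ` E"
      then obtain e0 where e0: "e0 \<in> E" "y = c e0" by auto
      let ?f = "(*) (mat_adjoint e0)"
      have "inj_on ?f {x\<in>E. c x = y}"
      proof (rule inj_onI)
        fix x z assume xz: "x \<in> {x\<in>E. c x = y}" "z \<in> {x\<in>E. c x = y}" "mat_adjoint e0 * x = mat_adjoint e0 * z"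
        then have d: "x \<in> carrier_mat n n" "z \<in> carrier_mat n n" using EU(1) unitaryD(1) by blast+
        show "x = z" using unitary_cancel(2)[OF EU(1)[OF e0(1)] d(1)] unitary_cancel(2)[OF EU(1)[OF e0(1)] d(2)] xz(3) by metis
      qed
      moreover have "?f ` {x\<in>E. c x = y} \<subseteq> W 8 \<inter> Z (insert g G)"
      proof (rule image_subsetI)
        fix x assume "x \<in> {x\<in>E. c x = y}"
        then have x: "x \<in> E" "c x = c e0" using e0 by auto
        let ?b = "mat_adjoint e0 * x"
        have b: "?b \<in> Z G" by (intro Z_mult Z_adjoint Gc EU(3) e0 x)
        have bU: "?b \<in> U" and bc: "?b \<in> carrier_mat n n" using b by (auto simp: cent_def)
        \<comment> \<open>Equality of commutators is the case \<open>q = 1\<close> of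
          \<open>commutator_quotient\<close>; it says that \<open>?b\<close> commutes with
          \<open>g\<close>.\<close>
        have "?b * g * mat_adjoint ?b = g * mat_adjoint (1\<^sub>m n)"
        proof (rule commutator_quotient[OF g(3) EU(1)[OF e0(1)] EU(1)[OF x(1)]])
          show "1\<^sub>m n = mat_adjoint (g * e0 * mat_adjoint g * mat_adjoint e0) * (g * x * mat_adjoint g * mat_adjoint x)"
            using unitaryD(2)[OF cU[OF e0(1)]] x(2) by (simp add: c_def)
        qed (use unitaryD(1)[OF g(3)] unitaryD(1)[OF EU(1)[OF e0(1)]] in auto)
        then have "?b * g * mat_adjoint ?b * ?b = g * ?b" using unitaryD(1)[OF g(3)] by (simp add: mat_adjoint_one)
        moreover have "?b * g * mat_adjoint ?b * ?b = ?b * g * (mat_adjoint ?b * ?b)"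
          by (rule assoc_mult_mat[OF square_mult_carrier[OF bc unitaryD(1)[OF g(3)]] unitaryD(4)[OF bU] bc])
        moreover have "\<dots> = ?b * g"
          unfolding unitaryD(2)[OF bU]
          by (rule right_mult_one_mat[OF square_mult_carrier[OF bc unitaryD(1)[OF g(3)]]])
        ultimately have "?b * g = g * ?b" by simp
        then have "?b \<in> Z (insert g G)" using b by (auto simp: cent_def)
        moreover have "?b \<in> W 8" using W_mult_mat[OF W_adjoint[OF EU(2)[OF e0(1)]] EU(2)[OF x(1)]] by simp
        ultimately show "?b \<in> W 8 \<inter> Z (insert g G)" by simp
      qed
      ultimately show "card {x\<in>E. c x = y} \<le> card (W 8 \<inter> Z (insert g G))"
        by (rule card_inj_on_le) (use finite_W in auto)
    qed (use finE in auto)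
    then have "real (card E) \<le> real (card (W 8 \<inter> Z (insert g G))) * real (card (c ` E))"
      unfolding of_nat_mult[symmetric] of_nat_le_iff .
    \<comment> \<open>The total exponent 20 is 8 for shortening words of length 8 plus 12 for the
      number of commutators.\<close>
    also have "\<dots> \<le> (K ^ 8 * real (card (W 2 \<inter> Z (insert g G)))) * K ^ 12"
      using K0 by (intro mult_mono cardc card_W_subgroup subgroup_unitary_cent Gi) auto
    also have "\<dots> = K ^ 20 * real (card (W 2 \<inter> Z (insert g G)))"
      by (simp add: mult_ac flip: power_add mult.assoc)
    finally have "cover * real (card E) \<le> cover * (K ^ 20 * real (card (W 2 \<inter> Z (insert g G))))"
      using cover_ge_1 by (intro mult_left_mono) auto
    then have "real (card (W 2 \<inter> Z G)) \<le> cover * K ^ 20 * real (card (W 2 \<inter> Z (insert g G)))"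
      using E(2) by (simp add: mult.assoc)
    then show ?thesis using g by blast
  qed
qed

end

section \<open>Iteration to a large abelian subgroup\<close>

context unitary_tripling
begin

lemma Z_empty: "Z {} = U"
  using unitaryD(1) by (auto simp: cent_def)

lemma Z_Un: "Z (X \<union> Y) = Z X \<inter> Z Y"
  by (auto simp: cent_def)

lemma card_A_le_W_2: "card A \<le> card (W 2)"
proof -
  obtain a where a: "a \<in> A" using A_ne by auto
  show ?thesis
  proof (rule card_inj_on_le[OF _ _ finite_W])
    show "inj_on (\<lambda>x. a \<otimes>\<^bsub>unitary_group n\<^esub> x) A"
      using a A_carrier by (intro inj_onI) (metis Units_eq Units_l_cancel in_mono)
    show "(\<lambda>x. a \<otimes>\<^bsub>unitary_group n\<^esub> x) ` A \<subseteq> W 2"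
      using W_mult[of a "Suc 0" _ "Suc 0"] a unfolding W_1 numeral_2_eq_2 by auto
  qed
qed

text \<open>\<open>m\<close> counts the rounds still available and \<open>M\<close> accumulates the
  losses. A chain of commuting unitaries has length below \<open>n\<close>, so \<open>m = 0\<close>
  cannot occur and the iteration stops through the first alternative of
  \<open>ex_large_centralizer\<close>.\<close>

lemma ex_large_abelian_aux:
  assumes "set us \<subseteq> U" "\<And>u v. u \<in> set us \<Longrightarrow> v \<in> set us \<Longrightarrow> u * v = v * u" "comm_chain n us"
    "length us + m = n" "M \<ge> 0" "real (card A) \<le> M * real (card (W 2 \<inter> Z (set us)))"
  shows "\<exists>X\<subseteq>carrier_mat n n. (\<forall>x\<in>Z X. \<forall>y\<in>Z X. x * y = y * x) \<and>
    real (card A) \<le> M * (cover * K ^ 20) ^ m * real (card (W 2 \<inter> Z X))"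
  using assms
proof (induction m arbitrary: us M)
  case 0
  then show ?case using comm_chain_length[OF 0(1,2,3) n_pos] by simp
next
  case (Suc m)
  have usc: "set us \<subseteq> carrier_mat n n" using Suc.prems(1) unitaryD(1) by blast
  have ck: "cover * K ^ 20 \<ge> 1"
    using mult_mono[of 1 cover 1 "K ^ 20"] cover_ge_1 K_ge_1 by simp
  from ex_large_centralizer[OF Suc.prems(1)] show ?case
  proof (elim disjE bexE conjE)
    assume le: "real (card (W 2 \<inter> Z (set us))) \<le> cover * K ^ 20 * real (card (W 2 \<inter> Z (cent n (set us))))"
    show ?thesis
    proof (intro exI[of _ "cent n (set us)"] conjI ballI cent_carrier)
      fix x y assume x: "x \<in> Z (cent n (set us))" and y: "y \<in> Z (cent n (set us))"
      \<comment> \<open>A commuting set lies in its own commutant, hence its double commutant is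
        commutative.\<close>
      have "set us \<subseteq> cent n (set us)" using usc Suc.prems(2) by (auto simp: cent_def)
      then have "y \<in> cent n (set us)" using y by (auto simp: cent_def)
      then show "x * y = y * x" using x centD(2) by blast
    next
      have "real (card A) \<le> M * (cover * K ^ 20 * real (card (W 2 \<inter> Z (cent n (set us)))))"
        using Suc.prems(5,6) le by (meson mult_left_mono order_trans)
      also have "\<dots> \<le> M * ((cover * K ^ 20) ^ Suc m * real (card (W 2 \<inter> Z (cent n (set us)))))"
        using Suc.prems(5) ck by (intro mult_left_mono mult_right_mono self_le_power) auto
      finally show "real (card A) \<le> M * (cover * K ^ 20) ^ Suc m * real (card (W 2 \<inter> Z (cent n (set us))))"
        by (simp only: mult.assoc)
    qed
  next
    fix g assume g: "g \<in> W 2 \<inter> Z (set us)" "g \<notin> cent n (cent n (set us))"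
      and le: "real (card (W 2 \<inter> Z (set us))) \<le> cover * K ^ 20 * real (card (W 2 \<inter> Z (insert g (set us))))"
    \<comment> \<open>Being outside the double commutant, \<open>g\<close> fails to commute with
      some \<open>x\<close> in the commutant of \<open>us\<close>; this \<open>x\<close> is the
      witness that lengthens the chain.\<close>
    obtain x where x: "x \<in> cent n (set us)" "g * x \<noteq> x * g"
      using g by (auto simp: cent_def)
    have "\<exists>X\<subseteq>carrier_mat n n. (\<forall>x\<in>Z X. \<forall>y\<in>Z X. x * y = y * x) \<and>
      real (card A) \<le> M * (cover * K ^ 20) * (cover * K ^ 20) ^ m * real (card (W 2 \<inter> Z X))"
    proof (rule Suc.IH[of "g # us"])
      show "u * v = v * u" if "u \<in> set (g # us)" "v \<in> set (g # us)" for u v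
        using that g(1) Suc.prems(2) by (auto simp: cent_def)
      show "comm_chain n (g # us)"
        using Suc.prems(3) x by (auto simp: cent_def intro!: bexI[of _ x])
      have "real (card A) \<le> M * (cover * K ^ 20 * real (card (W 2 \<inter> Z (insert g (set us)))))"
        using Suc.prems(5,6) le by (meson mult_left_mono order_trans)
      then show "real (card A) \<le> M * (cover * K ^ 20) * real (card (W 2 \<inter> Z (set (g # us))))"
        by (simp add: mult.assoc)
    qed (use Suc.prems g ck in auto)
    then show ?thesis by (simp only: power_Suc mult.assoc)
  qed
qed

lemma ex_large_abelian:
  obtains X where "X \<subseteq> carrier_mat n n" "\<And>x y. x \<in> Z X \<Longrightarrow> y \<in> Z X \<Longrightarrow> x * y = y * x"
    "real (card A) \<le> (cover * K ^ 20) ^ n * real (card (W 2 \<inter> Z X))"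
proof -
  have "W 2 \<inter> Z {} = W 2" unfolding Z_empty using W_U by blast
  then have "real (card A) \<le> 1 * real (card (W 2 \<inter> Z (set [])))"
    using card_A_le_W_2 by simp
  from ex_large_abelian_aux[OF _ _ _ _ _ this, of n] show thesis
    using that by auto
qed

section \<open>Intersecting conjugates until the subgroup is normalised\<close>

definition conj_set :: "complex mat \<Rightarrow> complex mat set \<Rightarrow> complex mat set" where
  "conj_set g X = (\<lambda>x. g * x * mat_adjoint g) ` X"

lemma conj_set_carrier:
  assumes "g \<in> U" "X \<subseteq> carrier_mat n n"
  shows "conj_set g X \<subseteq> carrier_mat n n"
  using unitaryD[OF assms(1)] assms(2) by (auto simp: conj_set_def intro!: square_mult_carrier)

lemma conj_in_Z_iff:
  assumes g: "g \<in> U" and X: "X \<subseteq> carrier_mat n n" and u: "u \<in> U"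
  shows "u \<in> Z (conj_set g X) \<longleftrightarrow> mat_adjoint g * u * g \<in> Z X"
proof -
  note gc = unitaryD[OF g] and uc = unitaryD[OF u]
  note ms = assoc_mult_mat[of _ n n _ n _ n] square_mult_carrier[of _ n]
    unitary_cancel[where m = n, OF g]
  have U: "mat_adjoint g * u * g \<in> U" by (intro unitary_mult mat_adjoint_in_unitary_group g u)
  have "(u * (g * x * mat_adjoint g) = g * x * mat_adjoint g * u) \<longleftrightarrow>
      (mat_adjoint g * u * g * x = x * (mat_adjoint g * u * g))" if "x \<in> X" for x
  proof -
    have x: "x \<in> carrier_mat n n" using that X by auto
    have 1: "mat_adjoint g * (u * (g * x * mat_adjoint g)) * g = mat_adjoint g * u * g * x"
      using gc uc x by (simp add: ms right_mult_one_mat[of _ n n])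
    have 2: "mat_adjoint g * (g * x * mat_adjoint g * u) * g = x * (mat_adjoint g * u * g)"
      using gc uc x by (simp add: ms)
    have 3: "g * (mat_adjoint g * u * g * x) * mat_adjoint g = u * (g * x * mat_adjoint g)"
      using gc uc x by (simp add: ms)
    have 4: "g * (x * (mat_adjoint g * u * g)) * mat_adjoint g = g * x * mat_adjoint g * u"
      using gc uc x by (simp add: ms right_mult_one_mat[of _ n n])
    show ?thesis using 1 2 3 4 by metis
  qed
  then show ?thesis using u U uc unitaryD(1)[OF U] by (auto simp: cent_def conj_set_def)
qed

text \<open>Conjugation by \<open>g\<close> embeds \<open>W 2 \<inter> Z X\<close> into the words of
  length \<open>2 * i + 2\<close> in the conjugate group, which \<open>card_W_subgroup\<close>
  shortens.\<close>

lemma card_conj_Z: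
  assumes g: "g \<in> W i" and X: "X \<subseteq> carrier_mat n n"
  shows "real (card (W 2 \<inter> Z X)) \<le> K ^ (2 * i + 2) * real (card (W 2 \<inter> Z (conj_set g X)))"
proof -
  have gU: "g \<in> U" using g by (rule W_U)
  note gc = unitaryD[OF gU]
  note ms = assoc_mult_mat[of _ n n _ n _ n] square_mult_carrier[of _ n]
    unitary_cancel[where m = n, OF gU]
  let ?f = "\<lambda>u. g * u * mat_adjoint g"
  have unconj: "mat_adjoint g * ?f u * g = u" if "u \<in> carrier_mat n n" for u
    using that gc by (simp add: ms right_mult_one_mat[of _ n n])
  have "card (W 2 \<inter> Z X) \<le> card (W (2 * i + 2) \<inter> Z (conj_set g X))"
  proof (rule card_inj_on_le[where f = ?f])
    show "inj_on ?f (W 2 \<inter> Z X)"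
    proof (rule inj_onI)
      fix u v assume uv: "u \<in> W 2 \<inter> Z X" "v \<in> W 2 \<inter> Z X" "?f u = ?f v"
      then have c: "u \<in> carrier_mat n n" "v \<in> carrier_mat n n" by (auto simp: cent_def)
      have "u = mat_adjoint g * ?f u * g" by (rule unconj[OF c(1), symmetric])
      also have "\<dots> = v" unfolding uv(3) by (rule unconj[OF c(2)])
      finally show "u = v" .
    qed
    show "?f ` (W 2 \<inter> Z X) \<subseteq> W (2 * i + 2) \<inter> Z (conj_set g X)"
    proof (rule image_subsetI)
      fix u assume u: "u \<in> W 2 \<inter> Z X"
      have "?f u \<in> W (i + 2 + i)" using u by (intro W_mult_mat W_adjoint g) auto
      then have "?f u \<in> W (2 * i + 2)" by (simp add: mult_2 add_ac)
      moreover have fU: "?f u \<in> U" using u by (intro unitary_mult mat_adjoint_in_unitary_group gU) auto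
      moreover have "mat_adjoint g * ?f u * g \<in> Z X"
        proof -
        have "u \<in> Z X" "u \<in> carrier_mat n n" using u by (auto simp: cent_def)
        then show ?thesis by (simp only: unconj)
      qed
      ultimately show "?f u \<in> W (2 * i + 2) \<inter> Z (conj_set g X)"
        using conj_in_Z_iff[OF gU X fU] by blast
    qed
  qed (use finite_W in auto)
  then have "real (card (W 2 \<inter> Z X)) \<le> real (card (W (2 * i + 2) \<inter> Z (conj_set g X)))" by simp
  also have "\<dots> \<le> K ^ (2 * i + 2) * real (card (W 2 \<inter> Z (conj_set g X)))"
    by (intro card_W_subgroup subgroup_unitary_cent conj_set_carrier gU X)
  finally show ?thesis .
qed

definition normalised :: "complex mat set \<Rightarrow> bool" where
  "normalised T \<longleftrightarrow> (\<forall>a\<in>A. \<forall>t\<in>T. a * t * mat_adjoint a \<in> T)"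

text \<open>If some \<open>a\<close> conjugates some \<open>t\<close> out of the group of a
  conjugator \<open>g\<close>, then \<open>t\<close> itself lies outside the group of
  \<open>h\<close>, the inverse of \<open>a\<close> times \<open>g\<close>. Adding \<open>h\<close>
  to \<open>L\<close> therefore shrinks the intersection strictly, and \<open>t\<close>,
  \<open>x\<close> witness this.\<close>

lemma conj_step:
  assumes X: "X \<subseteq> carrier_mat n n" and D: "D \<ge> 1" "real (card A) \<le> D * real (card (W 2 \<inter> Z X))"
    and L: "\<And>g. g \<in> L \<Longrightarrow> \<exists>i\<le>k. g \<in> W i"
    and M: "M \<ge> 0" "real (card A) \<le> M * real (card (W 2 \<inter> Z (\<Union>g\<in>L. conj_set g X)))"
    and not_normalised: "\<not> normalised (Z (\<Union>g\<in>L. conj_set g X))"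
  obtains h t x where "\<exists>i\<le>Suc k. h \<in> W i" "t \<in> Z (\<Union>g\<in>L. conj_set g X)" "x \<in> conj_set h X" "t * x \<noteq> x * t"
    "real (card A) \<le> M * (D * K ^ (2 * k + 11)) * real (card (W 2 \<inter> Z (\<Union>g\<in>insert h L. conj_set g X)))"
proof -
  let ?Y = "\<Union>g\<in>L. conj_set g X"
  have LU: "g \<in> U" if "g \<in> L" for g using L[OF that] W_U by blast
  have Yc: "?Y \<subseteq> carrier_mat n n" using conj_set_carrier[OF LU X] by blast
  obtain a t where a: "a \<in> A" and t: "t \<in> Z ?Y" and at: "a * t * mat_adjoint a \<notin> Z ?Y"
    using not_normalised by (auto simp: normalised_def)
  have aW: "a \<in> W (Suc 0)" using a by (simp add: W_1)
  then have aU: "a \<in> U" by (rule W_U)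
  have tU: "t \<in> U" using t by simp
  have atU: "a * t * mat_adjoint a \<in> U" by (intro unitary_mult mat_adjoint_in_unitary_group aU tU)
  then obtain g where g: "g \<in> L" "a * t * mat_adjoint a \<notin> Z (conj_set g X)"
    using at unitaryD(1)[OF atU] by (auto simp: cent_def)
  obtain i where i: "i \<le> k" "g \<in> W i" using L[OF g(1)] by blast
  have gU: "g \<in> U" by (rule LU[OF g(1)])
  define h where "h = mat_adjoint a * g"
  have hW: "h \<in> W (Suc i)" unfolding h_def using W_mult_mat[OF W_adjoint[OF aW] i(2)] by simp
  then have hU: "h \<in> U" by (rule W_U)
  have "mat_adjoint h * t * h = mat_adjoint g * (a * t * mat_adjoint a) * g"
    unfolding h_def using unitaryD[OF aU] unitaryD[OF gU] unitaryD[OF tU]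
    by (simp add: mat_adjoint_mult[of _ n n _ n] mat_adjoint_adjoint[of _ n n]
      assoc_mult_mat[of _ n n _ n _ n] square_mult_carrier[of _ n])
  then have "t \<notin> Z (conj_set h X)"
    using g(2) unfolding conj_in_Z_iff[OF gU X atU] conj_in_Z_iff[OF hU X tU] by simp
  then obtain x where x: "x \<in> conj_set h X" "t * x \<noteq> x * t"
    using tU unitaryD(1)[OF tU] by (auto simp: cent_def)
  let ?T = "real (card (W 2 \<inter> Z ?Y))" and ?H = "real (card (W 2 \<inter> Z (conj_set h X)))"
    and ?R = "real (card (W 2 \<inter> Z (\<Union>g\<in>insert h L. conj_set g X)))"
  have ZR: "Z (\<Union>g\<in>insert h L. conj_set g X) = Z ?Y \<inter> Z (conj_set h X)"
    using Z_Un[of "conj_set h X" ?Y] by auto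
  have K0: "K \<ge> 0" using K_ge_1 by simp
  have "real (card A) \<le> D * (K ^ (2 * Suc i + 2) * ?H)"
    using D card_conj_Z[OF hW X] by (meson mult_left_mono order_trans zero_le_one)
  also have "\<dots> \<le> D * (K ^ (2 * k + 4) * ?H)"
    using i K_ge_1 D by (intro mult_left_mono mult_right_mono power_increasing) auto
  finally have H: "real (card A) \<le> D * (K ^ (2 * k + 4) * ?H)" .
  \<comment> \<open>The two largeness bounds are multiplied so that \<open>card_W_inter\<close>
    applies; one factor \<open>card A\<close> cancels at the end. The exponent
    \<open>2 * k + 11\<close> is \<open>2 * k + 4\<close> from the conjugation by \<open>h\<close>
    plus 7 from the intersection.\<close>
  have "real (card A) * real (card A) \<le> (M * ?T) * (D * (K ^ (2 * k + 4) * ?H))"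
    using H M K0 D by (intro mult_mono) auto
  also have "\<dots> = M * D * K ^ (2 * k + 4) * (?T * ?H)" by (simp add: mult_ac)
  also have "\<dots> \<le> M * D * K ^ (2 * k + 4) * (K ^ 7 * real (card A) * ?R)"
    unfolding ZR using M D K0
    by (intro mult_left_mono card_W_inter subgroup_unitary_cent Yc conj_set_carrier hU X) auto
  also have "\<dots> = M * (D * K ^ (2 * k + 11)) * ?R * real (card A)"
  proof -
    have KK: "K ^ (2 * k + 11) = K ^ (2 * k + 4) * K ^ 7"
      unfolding power_add[symmetric] by (rule arg_cong[where f = "power K"]) simp
    show ?thesis unfolding KK by (simp only: mult_ac)
  qed
  finally have "real (card A) \<le> M * (D * K ^ (2 * k + 11)) * ?R"
    using card_A_pos by simp
  then show thesis using that[of h t x] hW i t x by blast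
qed

text \<open>The measure \<open>m\<close> bounds the chains inside the current intersection. It drops
  in every step, because a chain in the smaller group extends by \<open>t\<close>, with witness
  \<open>x\<close>, to a chain in the larger one. \<open>k\<close> bounds the length of the
  conjugators and rises by one per step, so \<open>k + m \<le> N\<close> gives one cost factor valid
  for all steps.\<close>

lemma ex_normalised_aux:
  assumes X: "X \<subseteq> carrier_mat n n" and D: "D \<ge> 1" "real (card A) \<le> D * real (card (W 2 \<inter> Z X))"
    and L: "\<And>g. g \<in> L \<Longrightarrow> \<exists>i\<le>k. g \<in> W i" and m: "\<And>us. set us \<subseteq> Z (\<Union>g\<in>L. conj_set g X) \<Longrightarrow> comm_chain n us \<Longrightarrow> length us \<le> m"
    and km: "k + m \<le> N" and M: "M \<ge> 0" "real (card A) \<le> M * real (card (W 2 \<inter> Z (\<Union>g\<in>L. conj_set g X)))"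
  shows "\<exists>Y\<subseteq>carrier_mat n n. normalised (Z Y) \<and> Z Y \<subseteq> Z (\<Union>g\<in>L. conj_set g X) \<and>
    real (card A) \<le> M * (D * K ^ (2 * N + 11)) ^ m * real (card (W 2 \<inter> Z Y))"
  using L m km M
proof (induction m arbitrary: L k M rule: less_induct)
  case (less m L k M)
  let ?Y = "\<Union>g\<in>L. conj_set g X" and ?F = "D * K ^ (2 * N + 11)"
  have F1: "?F \<ge> 1" using mult_mono[of 1 D 1 "K ^ (2 * N + 11)"] D(1) K_ge_1 by simp
  have LU: "g \<in> U" if "g \<in> L" for g using less.prems(1)[OF that] W_U by blast
  have Yc: "?Y \<subseteq> carrier_mat n n" using conj_set_carrier[OF LU X] by blast
  show ?case
  proof (cases "normalised (Z ?Y)")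
    case True
    have "M * real (card (W 2 \<inter> Z ?Y)) \<le> M * (?F ^ m * real (card (W 2 \<inter> Z ?Y)))"
      using less.prems(4) mult_right_mono[of 1 "?F ^ m" "real (card (W 2 \<inter> Z ?Y))"] one_le_power[OF F1]
      by (intro mult_left_mono) auto
    from order_trans[OF less.prems(5) this]
    have "real (card A) \<le> M * ?F ^ m * real (card (W 2 \<inter> Z ?Y))" by (simp only: mult.assoc)
    then show ?thesis using True Yc by blast
  next
    case False
    obtain h t x where h: "\<exists>i\<le>Suc k. h \<in> W i" and t: "t \<in> Z ?Y" and x: "x \<in> conj_set h X" "t * x \<noteq> x * t"
      and le: "real (card A) \<le> M * (D * K ^ (2 * k + 11)) * real (card (W 2 \<inter> Z (\<Union>g\<in>insert h L. conj_set g X)))"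
      by (rule conj_step[OF X D less.prems(1,4,5) False])
    let ?R = "Z (\<Union>g\<in>insert h L. conj_set g X)"
    have hU: "h \<in> U" using h W_U by blast
    have xc: "x \<in> carrier_mat n n" using conj_set_carrier[OF hU X] x(1) by blast
    have RY: "?R \<subseteq> Z ?Y" by (auto simp: cent_def)
    have chain: "Suc (length us) \<le> m" if "set us \<subseteq> ?R" "comm_chain n us" for us
    proof -
      have "v * x = x * v" if "v \<in> set us" for v
        using \<open>set us \<subseteq> ?R\<close> that x(1) by (auto simp: cent_def)
      then have "comm_chain n (t # us)" using that(2) x xc by auto
      moreover have "set (t # us) \<subseteq> Z ?Y" using t that(1) RY by auto
      ultimately show ?thesis using less.prems(2)[of "t # us"] by simp
    qed
    have m0: "m > 0" using chain[of "[]"] by simp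
    have "\<exists>Y\<subseteq>carrier_mat n n. normalised (Z Y) \<and> Z Y \<subseteq> ?R \<and>
      real (card A) \<le> M * ?F * ?F ^ (m - 1) * real (card (W 2 \<inter> Z Y))"
    proof (rule less.IH[of "m - 1" "insert h L" "Suc k"])
      show "\<exists>i\<le>Suc k. g \<in> W i" if "g \<in> insert h L" for g
        using that h less.prems(1)[of g] le_SucI by blast
      show "length us \<le> m - 1" if "set us \<subseteq> ?R" "comm_chain n us" for us
        using chain[OF that] by simp
      show "Suc k + (m - 1) \<le> N" using less.prems(3) m0 by simp
      have "M * (D * K ^ (2 * k + 11)) * real (card (W 2 \<inter> ?R)) \<le> M * ?F * real (card (W 2 \<inter> ?R))"
        using less.prems(3,4) K_ge_1 D
        by (intro mult_right_mono mult_left_mono power_increasing) auto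
      then show "real (card A) \<le> M * ?F * real (card (W 2 \<inter> ?R))" using le by (rule order_trans[rotated])
      show "M * ?F \<ge> 0" by (rule mult_nonneg_nonneg[OF less.prems(4) order_trans[OF zero_le_one F1]])
    qed (use m0 in simp)
    then obtain Y where Y: "Y \<subseteq> carrier_mat n n" "normalised (Z Y)" "Z Y \<subseteq> ?R"
      "real (card A) \<le> M * ?F * ?F ^ (m - 1) * real (card (W 2 \<inter> Z Y))" by blast
    have F: "M * ?F * ?F ^ (m - 1) = M * ?F ^ m"
    proof -
      have "?F ^ m = ?F * ?F ^ (m - 1)" using m0 by (cases m) simp_all
      then show ?thesis by (simp only: mult.assoc)
    qed
    show ?thesis
    proof (intro exI[of _ Y] conjI Y(1,2))
      show "Z Y \<subseteq> Z ?Y" using Y(3) RY by (rule order_trans)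
      show "real (card A) \<le> M * ?F ^ m * real (card (W 2 \<inter> Z Y))" using Y(4) unfolding F .
    qed
  qed
qed

text \<open>The iteration starts from the abelian group \<open>Z X\<close> with 1 as the only
  conjugator. Chains inside it consist of commuting unitaries, so \<open>m = N = n\<close> is
  admissible; every later group is a subgroup of \<open>Z X\<close> and hence abelian.\<close>

lemma ex_large_normalised:
  obtains Y where "Y \<subseteq> carrier_mat n n" "\<And>x y. x \<in> Z Y \<Longrightarrow> y \<in> Z Y \<Longrightarrow> x * y = y * x" "normalised (Z Y)"
    "real (card A) \<le> (cover * K ^ 20) ^ n * ((cover * K ^ 20) ^ n * K ^ (2 * n + 11)) ^ n * real (card (W 2 \<inter> Z Y))"
proof -
  obtain X where X: "X \<subseteq> carrier_mat n n" and XX: "\<And>x y. x \<in> Z X \<Longrightarrow> y \<in> Z X \<Longrightarrow> x * y = y * x"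
    and le: "real (card A) \<le> (cover * K ^ 20) ^ n * real (card (W 2 \<inter> Z X))"
    using ex_large_abelian by blast
  let ?D = "(cover * K ^ 20) ^ n"
  have ck: "cover * K ^ 20 \<ge> 1"
    using mult_mono[of 1 cover 1 "K ^ 20"] cover_ge_1 K_ge_1 by simp
  have D1: "?D \<ge> 1" by (rule one_le_power[OF ck])
  have c1: "conj_set (1\<^sub>m n) X = X"
  proof -
    have "1\<^sub>m n * x * mat_adjoint (1\<^sub>m n) = x" if "x \<in> X" for x
    proof -
      have "x \<in> carrier_mat n n" using X that by blast
      then show ?thesis by (simp add: mat_adjoint_one left_mult_one_mat[of _ n n] right_mult_one_mat[of _ n n])
    qed
    then show ?thesis unfolding conj_set_def by simp
  qed
  have eq: "Z (\<Union>g\<in>{1\<^sub>m n}. conj_set g X) = Z X" by (simp add: c1)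
  have "\<exists>Y\<subseteq>carrier_mat n n. normalised (Z Y) \<and> Z Y \<subseteq> Z (\<Union>g\<in>{1\<^sub>m n}. conj_set g X) \<and>
    real (card A) \<le> ?D * (?D * K ^ (2 * n + 11)) ^ n * real (card (W 2 \<inter> Z Y))"
  proof (rule ex_normalised_aux[OF X D1 le, where k = 0])
    show "length us \<le> n" if us: "set us \<subseteq> Z (\<Union>g\<in>{1\<^sub>m n}. conj_set g X)" "comm_chain n us" for us
    proof -
      have "length us < n"
      proof (rule comm_chain_length[OF _ _ us(2) n_pos])
        show "set us \<subseteq> U" using us(1) by auto
        show "u * v = v * u" if "u \<in> set us" "v \<in> set us" for u v
          using us(1) that unfolding eq by (intro XX) auto
      qed
      then show ?thesis by simp
    qed
    show "\<exists>i\<le>0. g \<in> W i" if "g \<in> {1\<^sub>m n}" for g using that by simp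
    show "0 + n \<le> n" by simp
    show "0 \<le> ?D" by (rule order_trans[OF zero_le_one D1])
    show "real (card A) \<le> ?D * real (card (W 2 \<inter> Z (\<Union>g\<in>{1\<^sub>m n}. conj_set g X)))"
      unfolding eq by (rule le)
  qed
  then obtain Y where Y: "Y \<subseteq> carrier_mat n n" "normalised (Z Y)" "Z Y \<subseteq> Z X"
    "real (card A) \<le> ?D * (?D * K ^ (2 * n + 11)) ^ n * real (card (W 2 \<inter> Z Y))"
    unfolding eq by (elim exE conjE) (rule that)
  show thesis
  proof (rule that[OF Y(1) _ Y(2,4)])
    fix x y assume "x \<in> Z Y" "y \<in> Z Y"
    then have "x \<in> Z X" "y \<in> Z X" using Y(3) by blast+
    then show "x * y = y * x" by (rule XX)
  qed
qed

end

section \<open>Connectedness\<close>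

lemma fun_calc_eqD:
  assumes V: "V \<in> carrier (unitary_group n)" and eq: "fun_calc n V d f = fun_calc n V d g" and i: "i < n"
  shows "f (d i) = g (d i)"
proof -
  note Vc = unitaryD[OF V]
  have diag: "mat_adjoint V * fun_calc n V d h * V = mat_diag n (\<lambda>i. h (d i))" for h
    unfolding fun_calc_def using Vc
    by (simp add: assoc_mult_mat[of _ n n _ n _ n] square_mult_carrier[of _ n] unitary_cancel[where m = n, OF V]
      right_mult_one_mat[of _ n n])
  have "mat_diag n (\<lambda>i. f (d i)) = mat_diag n (\<lambda>i. g (d i))"
    unfolding diag[symmetric] eq ..
  then have "mat_diag n (\<lambda>i. f (d i)) $$ (i, i) = mat_diag n (\<lambda>i. g (d i)) $$ (i, i)" by simp
  then show ?thesis using i by (simp add: mat_diag_def)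
qed

lemma continuous_map_mat_topology:
  assumes p: "\<And>t. t \<in> topspace X \<Longrightarrow> p t \<in> carrier_mat n n"
    and c: "\<And>i j. i < n \<Longrightarrow> j < n \<Longrightarrow> continuous_map X euclidean (\<lambda>t. p t $$ (i, j))"
  shows "continuous_map X (mat_topology n) p"
  unfolding mat_topology_def
proof (rule continuous_map_pullback')
  show "topspace X \<subseteq> p -` carrier_mat n n" using p by auto
  show "continuous_map X (product_topology (\<lambda>_. euclidean) ({..<n} \<times> {..<n})) ((\<lambda>M. \<lambda>ij\<in>{..<n} \<times> {..<n}. M $$ ij) \<circ> p)"
    unfolding continuous_map_componentwise
  proof (intro conjI ballI)
    show "((\<lambda>M. \<lambda>ij\<in>{..<n} \<times> {..<n}. M $$ ij) \<circ> p) ` topspace X \<subseteq> extensional ({..<n} \<times> {..<n})" by auto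
    fix k assume k: "k \<in> {..<n} \<times> {..<n}"
    then obtain i j where "k = (i, j)" "i < n" "j < n" by auto
    then show "continuous_map X euclidean (\<lambda>x. ((\<lambda>M. \<lambda>ij\<in>{..<n} \<times> {..<n}. M $$ ij) \<circ> p) x k)"
      using c[of i j] by simp
  qed
qed

text \<open>Every \<open>u\<close> in the group is joined to 1 by a path of functions of
  \<open>u\<close>, which commute with everything that commutes with \<open>u\<close>. The group is
  the union of connected sets through 1.\<close>

lemma connectedin_unitary_cent:
  assumes Y: "Y \<subseteq> carrier_mat n n"
  shows "connectedin (mat_topology n) (carrier (unitary_group n) \<inter> cent n Y)"
proof -
  let ?S = "carrier (unitary_group n) \<inter> cent n Y"
  have ex: "\<exists>P. connectedin (mat_topology n) P \<and> P \<subseteq> ?S \<and> 1\<^sub>m n \<in> P \<and> u \<in> P" if u: "u \<in> ?S" for u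
  proof -
    have uU: "u \<in> carrier (unitary_group n)" using u by simp
    note uc = unitaryD[OF uU]
    obtain V d where V: "V \<in> carrier (unitary_group n)" "u = V * mat_diag n d * mat_adjoint V"
      using unitary_diagonalization[OF uU] by blast
    note ui = fun_calc_id[OF V]
    \<comment> \<open>Unitarity of \<open>u\<close>, read off on the eigenvalues, puts them on the
      unit circle.\<close>
    have "fun_calc n V d (\<lambda>z. cnj z * z) = fun_calc n V d (\<lambda>_. 1)"
      using uc(2) fun_calc_adjoint[OF V, of "\<lambda>z. z"] fun_calc_mult[OF V, of cnj "\<lambda>z. z"]
      by (simp add: ui fun_calc_one[OF V])
    note eq1 = fun_calc_eqD[OF V(1) this]
    have d1: "cmod (d i) = 1" if "i < n" for i
    proof -
      have "complex_of_real ((cmod (d i))\<^sup>2) = 1"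
        unfolding complex_norm_square using eq1[OF that] by (simp only: mult.commute)
      then have "(cmod (d i))\<^sup>2 = 1" by (simp only: of_real_eq_1_iff)
      then show ?thesis using norm_ge_zero[of "d i"] by (auto simp: power2_eq_1_iff)
    qed
    \<comment> \<open>\<open>Arg\<close> is evaluated only at the fixed eigenvalues, so its branch
      cut does not disturb continuity in \<open>t\<close>.\<close>
    define p where "p t = fun_calc n V d (\<lambda>z. cis (t * Arg z))" for t :: real
    have pc: "p t \<in> carrier_mat n n" for t unfolding p_def by (rule fun_calc_carrier[OF V])
    have pS: "p t \<in> ?S" for t
    proof
      have "mat_adjoint (p t) * p t = fun_calc n V d (\<lambda>z. cnj (cis (t * Arg z)) * cis (t * Arg z))"
        unfolding p_def fun_calc_adjoint[OF V] by (rule fun_calc_mult[OF V])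
      also have "\<dots> = 1\<^sub>m n" by (simp add: cis_cnj cis_mult fun_calc_one[OF V])
      finally show "p t \<in> carrier (unitary_group n)" by (rule unitaryI[OF pc])
      have "p t * y = y * p t" if "y \<in> Y" for y
        unfolding p_def using that u Y by (intro fun_calc_commute[OF V, symmetric]) (auto simp: cent_def)
      then show "p t \<in> cent n Y" using pc by (auto simp: cent_def)
    qed
    have p0: "p 0 = 1\<^sub>m n" by (simp add: p_def fun_calc_one[OF V])
    have p1: "p 1 = u"
    proof -
      have "cis (Arg (d k)) = d k" if "k < n" for k
      proof -
        have "d k \<noteq> 0" using d1[OF that] by auto
        then show ?thesis using d1[OF that] cis_Arg[of "d k"] by (simp add: sgn_eq)
      qed
      then have "p 1 = fun_calc n V d (\<lambda>z. z)"
        using fun_calc_carrier[OF V, of "\<lambda>z. z"] pc[of 1]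
        by (intro eq_matI) (auto simp: p_def fun_calc_index[OF V])
      then show ?thesis by (simp add: ui)
    qed
    have "continuous_map euclideanreal (mat_topology n) p"
    proof (rule continuous_map_mat_topology)
      fix i j assume ij: "i < n" "j < n"
      have "continuous_on UNIV (\<lambda>t. \<Sum>k<n. V $$ (i, k) * cis (t * Arg (d k)) * cnj (V $$ (j, k)))"
        by (intro continuous_intros)
      then show "continuous_map euclideanreal euclidean (\<lambda>t. p t $$ (i, j))"
        using ij by (simp add: p_def fun_calc_index[OF V])
    qed (rule pc)
    then have "connectedin (mat_topology n) (range p)"
      by (rule connectedin_continuous_map_image) simp
    then show ?thesis using pS p0 p1 by (intro exI[of _ "range p"]) (metis image_subsetI rangeI)
  qed
  define F where "F = {P. connectedin (mat_topology n) P \<and> P \<subseteq> ?S \<and> 1\<^sub>m n \<in> P}"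
  have "connectedin (mat_topology n) (\<Union>F)"
  proof (cases "F = {}")
    case False
    then show ?thesis by (intro connectedin_Union) (auto simp: F_def)
  qed simp
  moreover have "\<Union>F = ?S" using ex unfolding F_def by blast
  ultimately show ?thesis by simp
qed

section \<open>The size of the quotient\<close>

context unitary_tripling
begin

text \<open>\<open>normalised\<close> provides one inclusion for each \<open>a\<close>. The reverse
  one is the same inclusion for the adjoint of \<open>a\<close>, which belongs to \<open>A\<close>
  by symmetry.\<close>

lemma normalised_imp_normalizer:
  assumes T: "subgroup T (unitary_group n)" and norm: "normalised T"
  shows "A \<subseteq> normalizer (unitary_group n) T"
proof
  fix a assume a: "a \<in> A"
  have TU: "T \<subseteq> U" using T by (rule subgroup.subset)
  have aU: "a \<in> U" using a A_carrier by blast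
  have inv_a: "inv\<^bsub>unitary_group n\<^esub> a = mat_adjoint a" using aU by (rule inv_unitary_group)
  have a': "mat_adjoint a \<in> A" using A_inv[OF a] by (simp only: inv_a)
  note ac = unitaryD[OF aU]
  have "a <#\<^bsub>unitary_group n\<^esub> T #>\<^bsub>unitary_group n\<^esub> mat_adjoint a = (\<lambda>t. a * t * mat_adjoint a) ` T"
    by (auto simp: l_coset_def r_coset_def)
  also have "\<dots> = T"
  proof
    show "(\<lambda>t. a * t * mat_adjoint a) ` T \<subseteq> T" using norm a by (auto simp: normalised_def)
    show "T \<subseteq> (\<lambda>t. a * t * mat_adjoint a) ` T"
    proof
      fix t assume t: "t \<in> T"
      then have tc: "t \<in> carrier_mat n n" using TU unitaryD(1) by blast
      have "mat_adjoint a * t * mat_adjoint (mat_adjoint a) \<in> T"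
        using norm a' t by (auto simp: normalised_def)
      then have "mat_adjoint a * t * a \<in> T" using ac by (simp add: mat_adjoint_adjoint[of _ n n])
      moreover have "a * (mat_adjoint a * t * a) * mat_adjoint a = t"
        using ac tc by (simp add: assoc_mult_mat[of _ n n _ n _ n] square_mult_carrier[of _ n]
          unitary_cancel[where m = n, OF aU] right_mult_one_mat[of _ n n])
      ultimately show "t \<in> (\<lambda>t. a * t * mat_adjoint a) ` T" by (metis image_eqI)
    qed
  qed
  finally show "a \<in> normalizer (unitary_group n) T"
    using aU TU by (simp add: normalizer_def stabilizer_def inv_a)
qed

text \<open>For \<open>n \<ge> 2\<close> one has \<open>16 * n + 1 \<le> n ^ 6\<close>, so the
  exponent of \<open>n\<close> is at most 6 * 2n^2 * 2n^2 = 24n^4.\<close>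

lemma cover_power_le:
  assumes "n \<ge> 2"
  shows "cover ^ (n + n\<^sup>2) \<le> real n powr (24 * real n ^ 4)"
proof -
  have "(2::nat) ^ 5 \<le> n ^ 5" using assms by (intro power_mono) auto
  then have "32 * n \<le> n ^ 5 * n" by (intro mult_right_mono) auto
  then have "16 * n + 1 \<le> n ^ 6" using assms by (simp add: eval_nat_numeral)
  then have "(16 * n + 1) ^ (2 * n\<^sup>2) \<le> (n ^ 6) ^ (2 * n\<^sup>2)" by (rule power_mono) simp
  also have "\<dots> = n ^ (12 * n\<^sup>2)" by (simp flip: power_mult)
  finally have "((16 * n + 1) ^ (2 * n\<^sup>2)) ^ (n + n\<^sup>2) \<le> (n ^ (12 * n\<^sup>2)) ^ (n + n\<^sup>2)"
    by (rule power_mono) simp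
  also have "\<dots> = n ^ (12 * n\<^sup>2 * (n + n\<^sup>2))" by (rule power_mult[symmetric])
  also have "\<dots> \<le> n ^ (24 * n ^ 4)"
  proof (rule power_increasing)
    have "n + n\<^sup>2 \<le> 2 * n\<^sup>2" by (simp add: power2_eq_square)
    then have "12 * n\<^sup>2 * (n + n\<^sup>2) \<le> 12 * n\<^sup>2 * (2 * n\<^sup>2)" by (rule mult_left_mono) simp
    also have "\<dots> = 24 * n ^ 4" by (simp add: power2_eq_square power4_eq_xxxx)
    finally show "12 * n\<^sup>2 * (n + n\<^sup>2) \<le> 24 * n ^ 4" .
  qed (use n_pos in simp)
  finally have "real (((16 * n + 1) ^ (2 * n\<^sup>2)) ^ (n + n\<^sup>2)) \<le> real (n ^ (24 * n ^ 4))"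
    by (simp only: of_nat_le_iff)
  also have "\<dots> = real n powr real (24 * n ^ 4)"
    using n_pos by (simp only: of_nat_power powr_realpow of_nat_0_less_iff)
  finally show ?thesis unfolding cover_def by simp
qed

text \<open>For \<open>n = 1\<close> the power of \<open>n\<close> in the bound equals 1 and absorbs
  nothing, but the whole group is abelian and leaves a single coset. For larger \<open>n\<close>,
  \<open>card_cosets\<close> is combined with \<open>ex_large_normalised\<close>.\<close>

lemma ex_normalised_small_quotient:
  obtains Y where "Y \<subseteq> carrier_mat n n" "\<And>x y. x \<in> Z Y \<Longrightarrow> y \<in> Z Y \<Longrightarrow> x * y = y * x" "normalised (Z Y)"
    "real (card ((\<lambda>a. Z Y #>\<^bsub>unitary_group n\<^esub> a) ` A)) \<le> real n powr (54 * real n ^ 4) * K powr (54 * real n ^ 2)"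
proof (cases "n = 1")
  case True
  have ab: "x * y = y * x" if "x \<in> Z {}" "y \<in> Z {}" for x y
  proof -
    have "x \<in> carrier_mat 1 1" "y \<in> carrier_mat 1 1" using that by (auto simp: cent_def True)
    then show ?thesis by (intro eq_matI) (auto simp: scalar_prod_def mult.commute)
  qed
  have norm: "normalised (Z {})"
    unfolding normalised_def Z_empty using A_carrier by (auto intro!: unitary_mult mat_adjoint_in_unitary_group)
  have "(\<lambda>a. Z {} #>\<^bsub>unitary_group n\<^esub> a) ` A \<subseteq> {U}"
    using A_carrier coset_join2[OF _ subgroup_self] unfolding Z_empty by blast
  then have "card ((\<lambda>a. Z {} #>\<^bsub>unitary_group n\<^esub> a) ` A) \<le> 1"
    using card_mono[of "{U}"] by fastforce
  moreover have "1 \<le> real n powr (54 * real n ^ 4) * K powr (54 * real n ^ 2)"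
    using True K_ge_1 by (simp add: ge_one_powr_ge_zero)
  ultimately have "real (card ((\<lambda>a. Z {} #>\<^bsub>unitary_group n\<^esub> a) ` A)) \<le> real n powr (54 * real n ^ 4) * K powr (54 * real n ^ 2)"
    by linarith
  then show thesis using that[OF _ ab norm] by simp
next
  case False
  then have n2: "n \<ge> 2" using n_pos by simp
  obtain Y where Y: "Y \<subseteq> carrier_mat n n" "\<And>x y. x \<in> Z Y \<Longrightarrow> y \<in> Z Y \<Longrightarrow> x * y = y * x" "normalised (Z Y)"
    and le: "real (card A) \<le> (cover * K ^ 20) ^ n * ((cover * K ^ 20) ^ n * K ^ (2 * n + 11)) ^ n * real (card (W 2 \<inter> Z Y))"
    using ex_large_normalised by blast
  let ?B = "(cover * K ^ 20) ^ n * ((cover * K ^ 20) ^ n * K ^ (2 * n + 11)) ^ n"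
    and ?w = "real (card (W 2 \<inter> Z Y))" and ?p = "real (card ((\<lambda>a. Z Y #>\<^bsub>unitary_group n\<^esub> a) ` A))"
  have w: "?w > 0" using le card_A_pos by (cases "card (W 2 \<inter> Z Y) = 0") auto
  have "?p * ?w \<le> K * real (card A)" by (rule card_cosets[OF subgroup_unitary_cent[OF Y(1)]])
  also have "\<dots> \<le> K * (?B * ?w)" using le K_ge_1 by (intro mult_left_mono) auto
  finally have "?p * ?w \<le> (K * ?B) * ?w" by (simp only: mult.assoc)
  then have "?p \<le> K * ?B" using w by (rule mult_right_le_imp_le)
  also have "K * ?B = cover ^ (n + n\<^sup>2) * K ^ (1 + 20 * n + (20 * n + (2 * n + 11)) * n)"
  proof -
    have 1: "(cover * K ^ 20) ^ n = cover ^ n * K ^ (20 * n)"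
      by (simp add: power_mult_distrib flip: power_mult)
    have 2: "(cover ^ n * K ^ (20 * n) * K ^ (2 * n + 11)) ^ n = cover ^ (n * n) * K ^ ((20 * n + (2 * n + 11)) * n)"
      unfolding mult.assoc power_add[symmetric] power_mult_distrib power_mult[symmetric] ..
    show ?thesis unfolding 1 2 by (simp only: power2_eq_square power_add power_one_right mult_ac)
  qed
  also have "\<dots> \<le> real n powr (54 * real n ^ 4) * K powr (54 * real n ^ 2)"
  proof (rule mult_mono)
    show "cover ^ (n + n\<^sup>2) \<le> real n powr (54 * real n ^ 4)"
      by (rule order_trans[OF cover_power_le[OF n2]]) (use n2 in \<open>intro powr_mono; simp\<close>)
    have "n \<le> n\<^sup>2" "1 \<le> n\<^sup>2" using n_pos by (auto simp: power2_eq_square)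
    \<comment> \<open>Bounding 1 and \<open>n\<close> by \<open>n\<^sup>2\<close> gives the
      coefficient 1 + 31 + 22 = 54, the constant of the theorem.\<close>
    moreover have "1 + 20 * n + (20 * n + (2 * n + 11)) * n = 1 + 31 * n + 22 * n\<^sup>2"
      by (simp add: power2_eq_square algebra_simps)
    ultimately have "1 + 20 * n + (20 * n + (2 * n + 11)) * n \<le> 54 * n\<^sup>2" by linarith
    then have "K ^ (1 + 20 * n + (20 * n + (2 * n + 11)) * n) \<le> K ^ (54 * n\<^sup>2)"
      using K_ge_1 by (rule power_increasing)
    also have "\<dots> = K powr real (54 * n\<^sup>2)" using K_ge_1 by (subst powr_realpow) auto
    finally show "K ^ (1 + 20 * n + (20 * n + (2 * n + 11)) * n) \<le> K powr (54 * real n ^ 2)" by simp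
  qed (use K_ge_1 in auto)
  finally have "?p \<le> real n powr (54 * real n ^ 4) * K powr (54 * real n ^ 2)" .
  then show thesis using that[of Y] Y by blast
qed

end

lemma comm_group_unitary_cent:
  assumes Y: "Y \<subseteq> carrier_mat n n"
    and ab: "\<And>x y. x \<in> carrier (unitary_group n) \<inter> cent n Y \<Longrightarrow> y \<in> carrier (unitary_group n) \<inter> cent n Y \<Longrightarrow> x * y = y * x"
  shows "comm_group ((unitary_group n)\<lparr>carrier := carrier (unitary_group n) \<inter> cent n Y\<rparr>)"
proof (rule group.group_comm_groupI)
  show "group ((unitary_group n)\<lparr>carrier := carrier (unitary_group n) \<inter> cent n Y\<rparr>)"
    by (rule subgroup.subgroup_is_group[OF subgroup_unitary_cent[OF Y] group_unitary_group])
qed (use ab in simp)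

theorem mainTheorem3:
  shows "\<exists>C::real. C > 0 \<and>
    (\<forall>(n::nat) (K::real) (A::complex mat set).
      n \<ge> 1 \<longrightarrow> K \<ge> 1 \<longrightarrow>
      A \<subseteq> carrier (unitary_group n) \<longrightarrow> finite A \<longrightarrow>
      symmetric_subset (unitary_group n) A \<longrightarrow>
      real (card (A <#>\<^bsub>unitary_group n\<^esub> A <#>\<^bsub>unitary_group n\<^esub> A)) \<le> K * real (card A) \<longrightarrow>
      (\<exists>S. subgroup S (unitary_group n) \<and>
        comm_group ((unitary_group n)\<lparr>carrier := S\<rparr>) \<and>
        connectedin (mat_topology n) S \<and>
        A \<subseteq> normalizer (unitary_group n) S \<and>
        (let N = (unitary_group n)\<lparr>carrier := normalizer (unitary_group n) S\<rparr>;
             \<pi> = (\<lambda>a. S #>\<^bsub>N\<^esub> a)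
         in real (card (\<pi> ` A))
              \<le> real n powr (C * real n ^ 4) * K powr (C * real n ^ 2))))"
proof (intro exI[of _ 54] conjI allI impI)
  fix n :: nat and K :: real and A :: "complex mat set"
  assume n: "n \<ge> 1" and K: "K \<ge> 1" and A: "A \<subseteq> carrier (unitary_group n)" and fin: "finite A"
    and sym: "symmetric_subset (unitary_group n) A"
    and trip: "real (card (A <#>\<^bsub>unitary_group n\<^esub> A <#>\<^bsub>unitary_group n\<^esub> A)) \<le> K * real (card A)"
  let ?G = "unitary_group n" and ?b = "real n powr (54 * real n ^ 4) * K powr (54 * real n ^ 2)"
  have "\<exists>Y\<subseteq>carrier_mat n n. (\<forall>x\<in>carrier ?G \<inter> cent n Y. \<forall>y\<in>carrier ?G \<inter> cent n Y. x * y = y * x) \<and>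
    A \<subseteq> normalizer ?G (carrier ?G \<inter> cent n Y) \<and>
    real (card ((\<lambda>a. (carrier ?G \<inter> cent n Y) #>\<^bsub>?G\<^esub> a) ` A)) \<le> ?b"
  proof (cases "A = {}")
    \<comment> \<open>The empty set is outside the locale; the group of scalar unitaries serves for
      it.\<close>
    case True
    show ?thesis
    proof (intro exI[of _ "carrier_mat n n"] conjI ballI order_refl)
      fix x y assume "x \<in> carrier ?G \<inter> cent n (carrier_mat n n)" "y \<in> carrier ?G \<inter> cent n (carrier_mat n n)"
      then show "x * y = y * x" by (intro centD(2)[of x n "carrier_mat n n"] centD(1)[of y n]) auto
    qed (simp_all add: True)
  next
    case False
    have "small_tripling_axioms ?G A K"
      using fin A False K trip sym by unfold_locales (auto simp: symmetric_subset_def)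
    then interpret unitary_tripling n A K
      using n by (intro unitary_tripling.intro small_tripling.intro group_unitary_group unitary_tripling_axioms.intro) auto
    obtain Y where Y: "Y \<subseteq> carrier_mat n n" "\<And>x y. x \<in> Z Y \<Longrightarrow> y \<in> Z Y \<Longrightarrow> x * y = y * x" "normalised (Z Y)"
      "real (card ((\<lambda>a. Z Y #>\<^bsub>unitary_group n\<^esub> a) ` A)) \<le> ?b"
      using ex_normalised_small_quotient by blast
    then show ?thesis
      using normalised_imp_normalizer[OF subgroup_unitary_cent[OF Y(1)] Y(3)] by blast
  qed
  then obtain Y where Y: "Y \<subseteq> carrier_mat n n"
    and ab: "\<And>x y. x \<in> carrier ?G \<inter> cent n Y \<Longrightarrow> y \<in> carrier ?G \<inter> cent n Y \<Longrightarrow> x * y = y * x"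
    and norm: "A \<subseteq> normalizer ?G (carrier ?G \<inter> cent n Y)"
    and card: "real (card ((\<lambda>a. (carrier ?G \<inter> cent n Y) #>\<^bsub>?G\<^esub> a) ` A)) \<le> ?b"
    by blast
  \<comment> \<open>Right cosets depend only on the multiplication, so those formed in
    \<open>N\<close> agree with those formed in the unitary group.\<close>
  show "\<exists>S. subgroup S ?G \<and> comm_group (?G\<lparr>carrier := S\<rparr>) \<and> connectedin (mat_topology n) S \<and>
      A \<subseteq> normalizer ?G S \<and>
      (let N = ?G\<lparr>carrier := normalizer ?G S\<rparr>; \<pi> = (\<lambda>a. S #>\<^bsub>N\<^esub> a) in real (card (\<pi> ` A)) \<le> ?b)"
    using subgroup_unitary_cent[OF Y] comm_group_unitary_cent[OF Y ab] connectedin_unitary_cent[OF Y] norm card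
    by (intro exI[of _ "carrier ?G \<inter> cent n Y"]) (simp add: Let_def r_coset_def)
qed simp

end
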